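(* There are a computable function $m(j,\varepsilon)$ (of a positive integer $j$ and a positive rational $\varepsilon$) and an oracle algorithm with the following property: given any representation of a shift-invariant Borel probability measure $\mu$ on $2^{\mathbb{N}}$, the algorithm computes a sequence $(A_n)_{n\in\mathbb{N}}$ with $A_n \subseteq n = \{0,\ldots,n-1\}$ for each $n$, such that for every $j$, $\varepsilon$ and every $n \geq m(j,\varepsilon)$, $A_n$ is a $(j,\varepsilon)$-good approximation to $\mu$. Conversely, there is an oracle algorithm which, given a representation of such a function $m$ and such a sequence $(A_n)$ (i.e. such that for all $j,\varepsilon$ and all $n\ge m(j,\varepsilon)$, $A_n$ is a $(j,\varepsilon)$-good approximation to $\mu$), computes (a representation of) the measure $\mu$.
   Context: $2^{\mathbb{N}}$ is Cantor space; for a finite binary string $\sigma$, $[\sigma]$ is the cylinder set of infinite sequences extending $\sigma$; $T$ is the left shift $(T\omega)(k)=\omega(k+1)$, and shift-invariance means $\mu(T^{-1}B)=\mu(B)$ for all Borel $B$. A representation of a measure $\mu$ on $2^{\mathbb{N}}$ is a function $f$ from (finite binary strings)$\times\mathbb{N}$ to $\mathbb{Q}$ with $|\mu([\sigma]) - f(\sigma,i)| < 2^{-i}$ for all $\sigma, i$; computing a measure means computing such a representation. Algorithms may query their input (a representation, or a function/sequence given as an oracle) finitely often. A subset $A\subseteq n$ is identified with the binary string of length $n$ whose $i$th digit is $1$ iff $i\in A$; $\sigma$ occurs at position $i<n$ of $A$ if for every $j'$ less than the length of $\sigma$, the $j'$th bit of $\sigma$ equals bit $(i+j')\bmod n$ of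 $A$; $N_A(\sigma)$ is the number of such positions and $D_A(\sigma)=N_A(\sigma)/n$. $A$ is a $(j,\varepsilon)$-good approximation to $\mu$ if $|\mu([\sigma]) - D_A(\sigma)|<\varepsilon$ for every binary string $\sigma$ of length at most $j$. *)

theory Defs
  imports "HOL-Probability.Probability_Measure" "HOL-Library.Nat_Bijection"
begin

section \<open>Oracle algorithms\<close>

text \<open>
  Kleene's partial recursive functions relative to an oracle \<open>\<phi>\<close>. A program denotes a partial
  function on lists of natural numbers; \<open>halts \<phi> P xs y\<close> says that \<open>P\<close> with oracle \<open>\<phi>\<close> halts on
  input \<open>xs\<close> with output \<open>y\<close>. Derivations are finite, so a halting computation queries \<open>\<phi>\<close> only
  finitely often.
\<close>

datatype prog =
    Zero
  | Succ
  | Proj nat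
  | Query
  | Comp prog "prog list"
  | PrimRec prog prog
  | Minim prog

inductive halts :: "(nat \<Rightarrow> nat) \<Rightarrow> prog \<Rightarrow> nat list \<Rightarrow> nat \<Rightarrow> bool" for \<phi> where
  zero: "halts \<phi> Zero xs 0"
| succ: "halts \<phi> Succ (x # xs) (Suc x)"
| proj: "i < length xs \<Longrightarrow> halts \<phi> (Proj i) xs (xs ! i)"
| query: "halts \<phi> Query (x # xs) (\<phi> x)"
| comp: "list_all2 (\<lambda>g y. halts \<phi> g xs y) gs ys \<Longrightarrow> halts \<phi> f ys z \<Longrightarrow> halts \<phi> (Comp f gs) xs z"
| primrec_0: "halts \<phi> f xs y \<Longrightarrow> halts \<phi> (PrimRec f g) (0 # xs) y"
| primrec_Suc: "halts \<phi> (PrimRec f g) (n # xs) y \<Longrightarrow> halts \<phi> g (n # y # xs) z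
    \<Longrightarrow> halts \<phi> (PrimRec f g) (Suc n # xs) z"
| minim: "halts \<phi> f (n # xs) 0 \<Longrightarrow> (\<And>k. k < n \<Longrightarrow> \<exists>y>0. halts \<phi> f (k # xs) y)
    \<Longrightarrow> halts \<phi> (Minim f) xs n"

inductive_cases halts_elims:
  "halts \<phi> Zero xs y" "halts \<phi> Succ xs y" "halts \<phi> (Proj i) xs y" "halts \<phi> Query xs y"
  "halts \<phi> (Comp f gs) xs y" "halts \<phi> (PrimRec f g) (0 # xs) y"
  "halts \<phi> (PrimRec f g) (Suc n # xs) y" "halts \<phi> (Minim f) xs y"

lemma halts_deterministic: "halts \<phi> P xs y \<Longrightarrow> halts \<phi> P xs y' \<Longrightarrow> y = y'"
proof (induction arbitrary: y' rule: halts.induct)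
  case (comp xs gs ys f z)
  from comp.prems obtain ys' where
    ys': "list_all2 (\<lambda>g y. halts \<phi> g xs y) gs ys'" "halts \<phi> f ys' y'"
    by (rule halts_elims(5))
  have "ys = ys'"
  proof (rule nth_equalityI)
    show "length ys = length ys'"
      using list_all2_lengthD[OF comp.IH(1)] list_all2_lengthD[OF ys'(1)] by linarith
    show "ys ! i = ys' ! i" if "i < length ys" for i
      using list_all2_nthD2[OF comp.IH(1), of i] list_all2_nthD2[OF ys'(1), of i]
        that \<open>length ys = length ys'\<close> by simp
  qed
  then show ?case using comp.IH(2) ys'(2) by blast
next
  case (minim f n xs)
  from minim.prems have n': "halts \<phi> f (y' # xs) 0"
      "\<And>k. k < y' \<Longrightarrow> \<exists>y>0. halts \<phi> f (k # xs) y"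
    by (rule halts_elims(8), blast)+
  show ?case
  proof (cases n y' rule: linorder_cases)
    case less
    from n'(2)[OF less] obtain y where "y > 0" "halts \<phi> f (n # xs) y" by blast
    with minim.IH(1)[of y] show ?thesis by simp
  next
    case greater
    from minim.IH(2)[OF greater] obtain y where "y > 0" "\<forall>z. halts \<phi> f (y' # xs) z \<longrightarrow> y = z"
      by blast
    with n'(1) show ?thesis by blast
  qed
next
  case (primrec_Suc f g n xs y z)
  from primrec_Suc.prems obtain w where "halts \<phi> (PrimRec f g) (n # xs) w" "halts \<phi> g (n # w # xs) y'"
    by (rule halts_elims(7))
  then show ?case using primrec_Suc.IH by blast
next
  case (primrec_0 f xs y g)
  from primrec_0.prems have "halts \<phi> f xs y'" by (rule halts_elims(6))
  then show ?case by (rule primrec_0.IH)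
next
  case (query x xs) then show ?case by (rule halts_elims(4)) simp
next
  case (succ x xs) then show ?case by (rule halts_elims(2)) simp
next
  case (proj i xs) show ?case using proj.prems by (rule halts_elims(3)) simp
next
  case (zero xs) then show ?case by (rule halts_elims(1)) simp
qed

text \<open>
  Functions \<open>h :: 'a \<Rightarrow> 'b\<close> with domain \<open>X\<close> are handled through codings \<open>ca\<close> of arguments and \<open>cb\<close>
  of values by natural numbers. An oracle for \<open>h\<close> may behave arbitrarily off the codes of \<open>X\<close>.
\<close>

definition oracle_for :: "(nat \<Rightarrow> nat) \<Rightarrow> 'a set \<Rightarrow> ('a \<Rightarrow> nat) \<Rightarrow> ('b \<Rightarrow> nat) \<Rightarrow> ('a \<Rightarrow> 'b) \<Rightarrow> bool" where
  "oracle_for \<phi> X ca cb h \<longleftrightarrow> (\<forall>x\<in>X. \<phi> (ca x) = cb (h x))"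

definition computes :: "prog \<Rightarrow> (nat \<Rightarrow> nat) \<Rightarrow> 'a set \<Rightarrow> ('a \<Rightarrow> nat) \<Rightarrow> ('b \<Rightarrow> nat) \<Rightarrow> ('a \<Rightarrow> 'b) \<Rightarrow> bool" where
  "computes P \<phi> X ca cb h \<longleftrightarrow> (\<forall>x\<in>X. halts \<phi> P [ca x] (cb (h x)))"

definition computable :: "'a set \<Rightarrow> ('a \<Rightarrow> nat) \<Rightarrow> ('b \<Rightarrow> nat) \<Rightarrow> ('a \<Rightarrow> 'b) \<Rightarrow> bool" where
  "computable X ca cb h \<longleftrightarrow> (\<exists>P. computes P (\<lambda>_. 0) X ca cb h)"

text \<open>Two oracles presented as one: \<open>\<phi>\<close> on even numbers, \<open>\<psi>\<close> on odd numbers.\<close>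

definition oracle_join :: "(nat \<Rightarrow> nat) \<Rightarrow> (nat \<Rightarrow> nat) \<Rightarrow> nat \<Rightarrow> nat" where
  "oracle_join \<phi> \<psi> k = case_sum \<phi> \<psi> (sum_decode k)"

subsection \<open>Codings\<close>

definition string_encode :: "bool list \<Rightarrow> nat" where
  "string_encode \<sigma> = list_encode (map of_bool \<sigma>)"

text \<open>Rationals are coded by their reduced fraction with positive denominator.\<close>

definition rat_encode :: "rat \<Rightarrow> nat" where
  "rat_encode r = prod_encode (int_encode (fst (quotient_of r)), nat (snd (quotient_of r)))"

lemma inj_string_encode: "inj string_encode"
proof (rule injI)
  fix \<sigma> \<tau> assume "string_encode \<sigma> = string_encode \<tau>"
  then have "map (of_bool :: bool \<Rightarrow> nat) \<sigma> = map of_bool \<tau>"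
    unfolding string_encode_def by (simp add: list_encode_eq)
  then show "\<sigma> = \<tau>"
    by (rule map_injective) (simp add: inj_def of_bool_eq_iff)
qed

lemma inj_rat_encode: "inj rat_encode"
proof (rule injI)
  fix r s assume "rat_encode r = rat_encode s"
  then have "fst (quotient_of r) = fst (quotient_of s)"
    "nat (snd (quotient_of r)) = nat (snd (quotient_of s))"
    unfolding rat_encode_def by (simp_all add: prod_encode_eq int_encode_eq)
  then have "quotient_of r = quotient_of s"
    using quotient_of_denom_pos'[of r] quotient_of_denom_pos'[of s] by (simp add: prod_eq_iff)
  then show "r = s" by (rule quotient_of_inject)
qed

definition query_encode :: "bool list \<times> nat \<Rightarrow> nat" where
  "query_encode = (\<lambda>(\<sigma>, i). prod_encode (string_encode \<sigma>, i))"

definition precision_dom :: "(nat \<times> rat) set" where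
  "precision_dom = {(j, \<epsilon>). j > 0 \<and> \<epsilon> > 0}"

definition precision_encode :: "nat \<times> rat \<Rightarrow> nat" where
  "precision_encode = (\<lambda>(j, \<epsilon>). prod_encode (j, rat_encode \<epsilon>))"

section \<open>Measures on Cantor space\<close>

text \<open>
  Cantor space is the type \<^typ>\<open>nat \<Rightarrow> bool\<close>; \<^term>\<open>borel\<close> refers to its product topology, with
  \<^typ>\<open>bool\<close> discrete.
\<close>

definition cylinder :: "bool list \<Rightarrow> (nat \<Rightarrow> bool) set" where
  "cylinder \<sigma> = {\<omega>. \<forall>k<length \<sigma>. \<omega> k = \<sigma> ! k}"

definition shift :: "(nat \<Rightarrow> bool) \<Rightarrow> (nat \<Rightarrow> bool)" where
  "shift \<omega> = (\<lambda>k. \<omega> (k + 1))"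

definition shift_invariant_measure :: "(nat \<Rightarrow> bool) measure \<Rightarrow> bool" where
  "shift_invariant_measure \<mu> \<longleftrightarrow> prob_space \<mu> \<and> sets \<mu> = sets borel \<and>
     (\<forall>B \<in> sets borel. emeasure \<mu> (shift -` B) = emeasure \<mu> B)"

definition represents :: "(bool list \<times> nat \<Rightarrow> rat) \<Rightarrow> (nat \<Rightarrow> bool) measure \<Rightarrow> bool" where
  "represents f \<mu> \<longleftrightarrow>
     (\<forall>\<sigma> i. \<bar>measure \<mu> (cylinder \<sigma>) - of_rat (f (\<sigma>, i))\<bar> < 1 / 2 ^ i)"

section \<open>Good approximations\<close>

text \<open>
  A set \<open>A \<subseteq> {..<n}\<close> stands for the binary string of length \<open>n\<close> with \<open>k\<close>th bit \<open>k \<in> A\<close>, so \<open>n\<close> is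
  passed along with \<open>A\<close>.
\<close>

definition occurs_at :: "bool list \<Rightarrow> nat \<Rightarrow> nat set \<Rightarrow> nat \<Rightarrow> bool" where
  "occurs_at \<sigma> n A i \<longleftrightarrow> (\<forall>k<length \<sigma>. \<sigma> ! k = ((i + k) mod n \<in> A))"

definition occ_count :: "nat \<Rightarrow> nat set \<Rightarrow> bool list \<Rightarrow> nat" where
  "occ_count n A \<sigma> = card {i. i < n \<and> occurs_at \<sigma> n A i}"

definition occ_density :: "nat \<Rightarrow> nat set \<Rightarrow> bool list \<Rightarrow> real" where
  "occ_density n A \<sigma> = real (occ_count n A \<sigma>) / real n"

definition good_approx :: "nat \<Rightarrow> rat \<Rightarrow> nat \<Rightarrow> nat set \<Rightarrow> (nat \<Rightarrow> bool) measure \<Rightarrow> bool" where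
  "good_approx j \<epsilon> n A \<mu> \<longleftrightarrow>
     (\<forall>\<sigma>. length \<sigma> \<le> j \<longrightarrow> \<bar>measure \<mu> (cylinder \<sigma>) - occ_density n A \<sigma>\<bar> < of_rat \<epsilon>)"

definition approx_sequence :: "(nat \<times> rat \<Rightarrow> nat) \<Rightarrow> (nat \<Rightarrow> nat set) \<Rightarrow> (nat \<Rightarrow> bool) measure \<Rightarrow> bool" where
  "approx_sequence m A \<mu> \<longleftrightarrow> (\<forall>n. A n \<subseteq> {..<n}) \<and>
     (\<forall>j \<epsilon> n. j > 0 \<and> \<epsilon> > 0 \<and> n \<ge> m (j, \<epsilon>) \<longrightarrow> good_approx j \<epsilon> n (A n) \<mu>)"

end

theory Submission
  imports Defs
begin

text \<open>
  Good approximations exist with an explicit bound on \<open>n\<close>: cut a \<open>\<mu>\<close>-random sequence into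
  blocks of a fixed length \<open>M\<close> and concatenate the blocks with (rounded) multiplicities
  proportional to their probabilities. By shift invariance every position inside a block sees each
  short string with the right frequency, and a large \<open>M\<close> makes the block boundaries negligible. The
  algorithm need not know the bound: on input \<open>n\<close> it searches all \<open>A \<subseteq> n\<close> for one
  that is as good as any other, judged by approximations to \<open>\<mu>\<close> with error \<open>2\<^sup>-\<^sup>n\<close>. Conversely,
  \<open>D\<^bsub>A\<^esub>(\<sigma>)\<close> for \<open>A = A\<^sub>n\<close> with \<open>n\<close> beyond \<open>m(j, 2\<^sup>-\<^sup>i)\<close>, \<open>j \<ge> |\<sigma>|\<close>, is the required
  approximation to \<open>\<mu>[\<sigma>]\<close>. All searches are bounded, so every program is primitive recursive
  in the oracle.
\<close>

section \<open>Functionals computed by a program\<close>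

text \<open>
  The list argument serves as an environment of de Bruijn variables: in the rules for binders
  (\<open>rec_nat\<close>, sums, bounded quantifiers, bounded least-number search) the bound variable becomes
  \<open>hd xs\<close> and the enclosing environment \<open>tl xs\<close>. Predicates are represented through \<open>of_bool\<close>.
\<close>

definition rec_op :: "nat \<Rightarrow> ((nat \<Rightarrow> nat) \<Rightarrow> nat list \<Rightarrow> nat) \<Rightarrow> bool" where
  "rec_op k F \<longleftrightarrow> (\<exists>P. \<forall>\<phi> xs. length xs = k \<longrightarrow> halts \<phi> P xs (F \<phi> xs))"

lemma rec_opI: "(\<And>\<phi> xs. length xs = k \<Longrightarrow> halts \<phi> P xs (F \<phi> xs)) \<Longrightarrow> rec_op k F"
  unfolding rec_op_def by blast

lemma rec_op_cong:
  assumes "rec_op k F" "\<And>\<phi> xs. length xs = k \<Longrightarrow> F \<phi> xs = G \<phi> xs"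
  shows "rec_op k G"
  using assms unfolding rec_op_def by fastforce

text \<open>Each component has a program that serves all oracles and inputs, so one choice of
  programs, made before either is given, can be written into \<open>Comp\<close>.\<close>

lemma rec_op_comp:
  fixes F :: "(nat \<Rightarrow> nat) \<Rightarrow> nat list \<Rightarrow> nat"
  assumes F: "rec_op (length Gs) F" and Gs: "\<And>G. G \<in> set Gs \<Longrightarrow> rec_op k G"
  shows "rec_op k (\<lambda>\<phi> xs. F \<phi> (map (\<lambda>G. G \<phi> xs) Gs))"
proof -
  obtain P where P: "\<And>\<phi> xs. length xs = length Gs \<Longrightarrow> halts \<phi> P xs (F \<phi> xs)"
    using F unfolding rec_op_def by blast
  have "\<forall>G\<in>set Gs. \<exists>Q. \<forall>\<phi> xs. length xs = k \<longrightarrow> halts \<phi> Q xs (G \<phi> xs)"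
    using Gs unfolding rec_op_def by blast
  then obtain Q where Q: "\<And>G \<phi> xs. G \<in> set Gs \<Longrightarrow> length xs = k \<Longrightarrow> halts \<phi> (Q G) xs (G \<phi> xs)"
    by metis
  show ?thesis
  proof (rule rec_opI)
    fix \<phi> :: "nat \<Rightarrow> nat" and xs :: "nat list" assume "length xs = k"
    then have "list_all2 (\<lambda>g y. halts \<phi> g xs y) (map Q Gs) (map (\<lambda>G. G \<phi> xs) Gs)"
      by (auto simp: list_all2_conv_all_nth Q)
    then show "halts \<phi> (Comp P (map Q Gs)) xs (F \<phi> (map (\<lambda>G. G \<phi> xs) Gs))"
      by (rule halts.comp) (simp add: P)
  qed
qed

lemma rec_op_nth: "i < k \<Longrightarrow> rec_op k (\<lambda>\<phi> xs. xs ! i)"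
  by (rule rec_opI[of _ "Proj i"]) (simp add: halts.proj)

lemma rec_op_hd: "rec_op (Suc k) (\<lambda>\<phi> xs. hd xs)"
  by (rule rec_op_cong[OF rec_op_nth[of 0]]) (auto simp: length_Suc_conv)

text \<open>Composition with the projections \<open>1, ..., k\<close>. It moves a functional below
  one more binder, whose variable it ignores.\<close>

lemma rec_op_weaken:
  assumes "rec_op k F"
  shows "rec_op (Suc k) (\<lambda>\<phi> xs. F \<phi> (tl xs))"
proof -
  let ?Gs = "map (\<lambda>i (\<phi> :: nat \<Rightarrow> nat) xs. xs ! Suc i) [0..<k]"
  have "rec_op (Suc k) (\<lambda>\<phi> xs. F \<phi> (map (\<lambda>G. G \<phi> xs) ?Gs))"
    by (rule rec_op_comp) (use assms in \<open>auto intro: rec_op_nth\<close>)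
  then show ?thesis
  proof (rule rec_op_cong)
    fix \<phi> :: "nat \<Rightarrow> nat" and xs :: "nat list" assume "length xs = Suc k"
    then have "map (\<lambda>G. G \<phi> xs) ?Gs = tl xs"
      by (intro nth_equalityI) (auto simp: nth_tl)
    then show "F \<phi> (map (\<lambda>G. G \<phi> xs) ?Gs) = F \<phi> (tl xs)" by simp
  qed
qed

lemmas rec_op_weaken2 = rec_op_weaken[THEN rec_op_weaken]

lemma rec_op_Suc: "rec_op k F \<Longrightarrow> rec_op k (\<lambda>\<phi> xs. Suc (F \<phi> xs))"
proof -
  assume F: "rec_op k F"
  have "rec_op (length [F]) (\<lambda>\<phi> xs. Suc (hd xs))"
    by (rule rec_opI[of _ Succ]) (auto simp: length_Suc_conv halts.succ)
  from rec_op_comp[OF this] F show ?thesis by simp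
qed

lemma rec_op_query: "rec_op k F \<Longrightarrow> rec_op k (\<lambda>\<phi> xs. \<phi> (F \<phi> xs))"
proof -
  assume F: "rec_op k F"
  have "rec_op (length [F]) (\<lambda>\<phi> xs. \<phi> (hd xs))"
    by (rule rec_opI[of _ Query]) (auto simp: length_Suc_conv halts.query)
  from rec_op_comp[OF this] F show ?thesis by simp
qed

lemma rec_op_const: "rec_op k (\<lambda>\<phi> xs. c)"
proof (induction c)
  case 0 show ?case by (rule rec_opI[of _ Zero]) (rule halts.zero)
qed (rule rec_op_Suc)

text \<open>Putting the value of \<open>F\<close> in front of the environment turns the bound
  variable of \<open>G\<close> into that value. Recursion needs this because \<open>PrimRec\<close>
  takes its number of steps from the first argument.\<close>

lemma rec_op_let:
  fixes F :: "(nat \<Rightarrow> nat) \<Rightarrow> nat list \<Rightarrow> nat"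
  assumes "rec_op k F" and "rec_op (Suc k) (\<lambda>\<phi> xs. G \<phi> (tl xs) (hd xs))"
  shows "rec_op k (\<lambda>\<phi> xs. G \<phi> xs (F \<phi> xs))"
proof -
  let ?Gs = "F # map (\<lambda>i (\<phi> :: nat \<Rightarrow> nat) xs. xs ! i) [0..<k]"
  have "rec_op k (\<lambda>\<phi> xs. (\<lambda>\<phi> xs. G \<phi> (tl xs) (hd xs)) \<phi> (map (\<lambda>G. G \<phi> xs) ?Gs))"
    by (rule rec_op_comp) (use assms in \<open>auto intro: rec_op_nth\<close>)
  then show ?thesis
  proof (rule rec_op_cong)
    fix \<phi> :: "nat \<Rightarrow> nat" and xs :: "nat list" assume "length xs = k"
    then have "map ((\<lambda>G. G \<phi> xs) \<circ> (\<lambda>i \<phi> xs. xs ! i)) [0..<k] = xs"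
      by (intro nth_equalityI) auto
    then show "(\<lambda>\<phi> xs. G \<phi> (tl xs) (hd xs)) \<phi> (map (\<lambda>G. G \<phi> xs) ?Gs) = G \<phi> xs (F \<phi> xs)"
      by simp
  qed
qed

text \<open>\<open>PrimRec\<close> hands the counter and then the previous value to its step
  program, so below this binder \<open>hd xs\<close> is the counter and \<open>hd (tl xs)\<close>
  the accumulated value.\<close>

lemma rec_op_rec_nat:
  assumes B: "rec_op k B" and S: "rec_op (Suc (Suc k)) (\<lambda>\<phi> xs. S \<phi> (tl (tl xs)) (hd xs) (hd (tl xs)))"
    and N: "rec_op k N"
  shows "rec_op k (\<lambda>\<phi> xs. rec_nat (B \<phi> xs) (S \<phi> xs) (N \<phi> xs))"
proof (rule rec_op_let[OF N])
  obtain P where P: "\<And>\<phi> xs. length xs = k \<Longrightarrow> halts \<phi> P xs (B \<phi> xs)"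
    using B unfolding rec_op_def by blast
  obtain Q where Q: "\<And>\<phi> xs. length xs = Suc (Suc k) \<Longrightarrow> halts \<phi> Q xs (S \<phi> (tl (tl xs)) (hd xs) (hd (tl xs)))"
    using S unfolding rec_op_def by blast
  have *: "halts \<phi> (PrimRec P Q) (n # xs) (rec_nat (B \<phi> xs) (S \<phi> xs) n)" if "length xs = k" for \<phi> xs n
  proof (induction n)
    case 0 show ?case by (simp add: halts.primrec_0 P that)
  next
    case (Suc n)
    show ?case
      using halts.primrec_Suc[OF Suc] Q[of "n # rec_nat (B \<phi> xs) (S \<phi> xs) n # xs" \<phi>] that by simp
  qed
  show "rec_op (Suc k) (\<lambda>\<phi> xs. rec_nat (B \<phi> (tl xs)) (S \<phi> (tl xs)) (hd xs))"
    by (rule rec_opI[of _ "PrimRec P Q"]) (auto simp: length_Suc_conv *)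
qed

lemmas rec_op_hd_tl = rec_op_weaken[OF rec_op_hd] 

section \<open>Primitive recursive arithmetic\<close>

lemma rec_op_add:
  assumes F: "rec_op k F" and G: "rec_op k G"
  shows "rec_op k (\<lambda>\<phi> xs. F \<phi> xs + G \<phi> xs)"
proof (rule rec_op_cong)
  show "rec_op k (\<lambda>\<phi> xs. rec_nat (F \<phi> xs) (\<lambda>i y. Suc y) (G \<phi> xs))"
    by (intro rec_op_rec_nat rec_op_Suc rec_op_hd_tl F G)
  show "rec_nat x (\<lambda>i y. Suc y) n = x + n" for x n :: nat by (induction n) auto
qed

lemma rec_op_mult:
  assumes F: "rec_op k F" and G: "rec_op k G"
  shows "rec_op k (\<lambda>\<phi> xs. F \<phi> xs * G \<phi> xs)"
proof (rule rec_op_cong)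
  show "rec_op k (\<lambda>\<phi> xs. rec_nat 0 (\<lambda>i y. y + F \<phi> xs) (G \<phi> xs))"
    by (intro rec_op_rec_nat rec_op_const rec_op_add rec_op_hd_tl F[THEN rec_op_weaken2] G)
  show "rec_nat 0 (\<lambda>i y. y + x) n = x * n" for x n :: nat by (induction n) auto
qed

lemma rec_op_power:
  assumes F: "rec_op k F" and G: "rec_op k G"
  shows "rec_op k (\<lambda>\<phi> xs. F \<phi> xs ^ G \<phi> xs)"
proof (rule rec_op_cong)
  show "rec_op k (\<lambda>\<phi> xs. rec_nat 1 (\<lambda>i y. y * F \<phi> xs) (G \<phi> xs))"
    by (intro rec_op_rec_nat rec_op_const rec_op_mult rec_op_hd_tl F[THEN rec_op_weaken2] G)
  show "rec_nat 1 (\<lambda>i y. y * x) n = x ^ n" for x n :: nat by (induction n) auto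
qed

lemma rec_op_diff:
  assumes F: "rec_op k F" and G: "rec_op k G"
  shows "rec_op k (\<lambda>\<phi> xs. F \<phi> xs - G \<phi> xs)"
proof (rule rec_op_cong)
  \<comment> \<open>The inner recursion returns its last counter, so it is the predecessor, with 0
    sent to 0; iterating it gives truncated subtraction.\<close>
  show "rec_op k (\<lambda>\<phi> xs. rec_nat (F \<phi> xs) (\<lambda>i y. rec_nat 0 (\<lambda>i z. i) y) (G \<phi> xs))"
    by (intro rec_op_rec_nat rec_op_const rec_op_hd rec_op_hd_tl F G)
  have pred: "rec_nat 0 (\<lambda>i z. i) y = y - 1" for y :: nat by (cases y) auto
  show "rec_nat x (\<lambda>i y. rec_nat 0 (\<lambda>i z. i) y) n = x - n" for x n :: nat
    by (induction n) (auto simp: pred)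
qed

section \<open>Comparisons, connectives and bounded search\<close>

lemma rec_op_le:
  assumes F: "rec_op k F" and G: "rec_op k G"
  shows "rec_op k (\<lambda>\<phi> xs. of_bool (F \<phi> xs \<le> G \<phi> xs))"
  by (rule rec_op_cong[where F = "\<lambda>\<phi> xs. 1 - (F \<phi> xs - G \<phi> xs)"])
    (intro rec_op_diff rec_op_const F G, auto)

lemma rec_op_not:
  assumes P: "rec_op k (\<lambda>\<phi> xs. of_bool (P \<phi> xs))"
  shows "rec_op k (\<lambda>\<phi> xs. of_bool (\<not> P \<phi> xs))"
  by (rule rec_op_cong[where F = "\<lambda>\<phi> xs. 1 - of_bool (P \<phi> xs)"])
    (intro rec_op_diff rec_op_const P, auto)

lemma rec_op_conj:
  assumes P: "rec_op k (\<lambda>\<phi> xs. of_bool (P \<phi> xs))" and Q: "rec_op k (\<lambda>\<phi> xs. of_bool (Q \<phi> xs))"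
  shows "rec_op k (\<lambda>\<phi> xs. of_bool (P \<phi> xs \<and> Q \<phi> xs))"
  by (rule rec_op_cong[where F = "\<lambda>\<phi> xs. of_bool (P \<phi> xs) * of_bool (Q \<phi> xs)"])
    (intro rec_op_mult P Q, auto)

lemma rec_op_imp:
  assumes P: "rec_op k (\<lambda>\<phi> xs. of_bool (P \<phi> xs))" and Q: "rec_op k (\<lambda>\<phi> xs. of_bool (Q \<phi> xs))"
  shows "rec_op k (\<lambda>\<phi> xs. of_bool (P \<phi> xs \<longrightarrow> Q \<phi> xs))"
  using rec_op_not[OF rec_op_conj[OF P rec_op_not[OF Q]]] by simp

lemma rec_op_disj:
  assumes P: "rec_op k (\<lambda>\<phi> xs. of_bool (P \<phi> xs))" and Q: "rec_op k (\<lambda>\<phi> xs. of_bool (Q \<phi> xs))"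
  shows "rec_op k (\<lambda>\<phi> xs. of_bool (P \<phi> xs \<or> Q \<phi> xs))"
  using rec_op_imp[OF rec_op_not[OF P] Q] by (simp add: disj_imp)

lemma rec_op_less:
  assumes F: "rec_op k F" and G: "rec_op k G"
  shows "rec_op k (\<lambda>\<phi> xs. of_bool (F \<phi> xs < G \<phi> xs))"
  using rec_op_not[OF rec_op_le[OF G F]] by (simp add: not_le)

lemma rec_op_eq:
  assumes F: "rec_op k F" and G: "rec_op k G"
  shows "rec_op k (\<lambda>\<phi> xs. of_bool (F \<phi> xs = G \<phi> xs))"
  using rec_op_conj[OF rec_op_le[OF F G] rec_op_le[OF G F]] by (simp add: eq_iff)

lemma rec_op_if:
  assumes P: "rec_op k (\<lambda>\<phi> xs. of_bool (P \<phi> xs))" and F: "rec_op k F" and G: "rec_op k G"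
  shows "rec_op k (\<lambda>\<phi> xs. if P \<phi> xs then F \<phi> xs else G \<phi> xs)"
  by (rule rec_op_cong[where F = "\<lambda>\<phi> xs. of_bool (P \<phi> xs) * F \<phi> xs + of_bool (\<not> P \<phi> xs) * G \<phi> xs"])
    (intro rec_op_add rec_op_mult rec_op_not P F G, auto)

text \<open>Inside a recursion the accumulated value stands between the counter and the outer
  environment. Projecting it away lets a body that knows only the counter be used there.\<close>

lemma rec_op_skip:
  assumes F: "rec_op (Suc k) (\<lambda>\<phi> xs. F \<phi> (tl xs) (hd xs))"
  shows "rec_op (Suc (Suc k)) (\<lambda>\<phi> xs. F \<phi> (tl (tl xs)) (hd xs))"
proof (rule rec_op_cong)
  let ?Gs = "(\<lambda>\<phi> xs. xs ! 0) # map (\<lambda>i (\<phi> :: nat \<Rightarrow> nat) xs. xs ! Suc (Suc i)) [0..<k]"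
  show "rec_op (Suc (Suc k)) (\<lambda>\<phi> xs. (\<lambda>\<phi> xs. F \<phi> (tl xs) (hd xs)) \<phi> (map (\<lambda>G. G \<phi> xs) ?Gs))"
    by (rule rec_op_comp) (use F in \<open>auto intro: rec_op_nth\<close>)
  fix \<phi> :: "nat \<Rightarrow> nat" and xs :: "nat list" assume len: "length xs = Suc (Suc k)"
  then have "map (\<lambda>G. G \<phi> xs) ?Gs = hd xs # tl (tl xs)"
    by (intro nth_equalityI) (auto simp: length_Suc_conv nth_Cons split: nat.splits)
  then show "(\<lambda>\<phi> xs. F \<phi> (tl xs) (hd xs)) \<phi> (map (\<lambda>G. G \<phi> xs) ?Gs) = F \<phi> (tl (tl xs)) (hd xs)"
    by (simp only: list.sel)
qed

lemma rec_op_sum: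
  assumes N: "rec_op k N" and F: "rec_op (Suc k) (\<lambda>\<phi> xs. F \<phi> (tl xs) (hd xs))"
  shows "rec_op k (\<lambda>\<phi> xs. \<Sum>i<N \<phi> xs. F \<phi> xs i)"
proof (rule rec_op_cong)
  show "rec_op k (\<lambda>\<phi> xs. rec_nat 0 (\<lambda>i y. y + F \<phi> xs i) (N \<phi> xs))"
    by (intro rec_op_rec_nat rec_op_const rec_op_add rec_op_hd_tl rec_op_skip N F)
  show "rec_nat 0 (\<lambda>i y. y + f i) n = (\<Sum>i<n. f i)" for f and n :: nat by (induction n) auto
qed

lemma rec_op_ball:
  assumes N: "rec_op k N" and P: "rec_op (Suc k) (\<lambda>\<phi> xs. of_bool (P \<phi> (tl xs) (hd xs)))"
  shows "rec_op k (\<lambda>\<phi> xs. of_bool (\<forall>i<N \<phi> xs. P \<phi> xs i))"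
proof (rule rec_op_cong)
  show "rec_op k (\<lambda>\<phi> xs. of_bool ((\<Sum>i<N \<phi> xs. of_bool (\<not> P \<phi> xs i)) = (0::nat)))"
    by (intro rec_op_eq rec_op_sum rec_op_const rec_op_not N P)
qed auto

lemma rec_op_bex:
  assumes N: "rec_op k N" and P: "rec_op (Suc k) (\<lambda>\<phi> xs. of_bool (P \<phi> (tl xs) (hd xs)))"
  shows "rec_op k (\<lambda>\<phi> xs. of_bool (\<exists>i<N \<phi> xs. P \<phi> xs i))"
  using rec_op_not[OF rec_op_ball[OF N rec_op_not[OF P]]] by simp

lemma rec_op_least:
  assumes N: "rec_op k N" and P: "rec_op (Suc k) (\<lambda>\<phi> xs. of_bool (P \<phi> (tl xs) (hd xs)))"
  shows "rec_op k (\<lambda>\<phi> xs. LEAST i. N \<phi> xs \<le> i \<or> P \<phi> xs i)"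
proof (rule rec_op_cong)
  \<comment> \<open>The least number is the count of those \<open>j\<close> below the bound up to
    which no witness has appeared; without any witness this is the bound itself.\<close>
  show "rec_op k (\<lambda>\<phi> xs. \<Sum>j<N \<phi> xs. of_bool (\<not> (\<exists>i<N \<phi> xs. i \<le> j \<and> P \<phi> xs i)))"
    by (intro rec_op_sum N rec_op_not rec_op_bex rec_op_conj rec_op_le rec_op_hd rec_op_hd_tl
        rec_op_skip[where F = "\<lambda>\<phi> xs i. of_bool (P \<phi> xs i)"] P N[THEN rec_op_weaken])
  show "(\<Sum>j<n. of_bool (\<not> (\<exists>i<n. i \<le> j \<and> p i))) = (LEAST i. n \<le> i \<or> p i)" (is "_ = ?L")
    for n :: nat and p
  proof -
    have L: "n \<le> ?L \<or> p ?L" by (rule LeastI[of "\<lambda>i. n \<le> i \<or> p i" n]) simp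
    have le: "?L \<le> i" if "n \<le> i \<or> p i" for i using that by (rule Least_le)
    have "{..<n} \<inter> {j. \<forall>i\<le>j. \<not> p i} = {..<?L}"
      using L le[of n] le by (auto simp: not_le) (meson le_less_trans not_le order.trans)+
    then show ?thesis by (simp add: sum_of_bool_eq)
  qed
qed

text \<open>A quotient never exceeds \<open>x\<close>, so a search bounded by \<open>x\<close> finds
  it. For \<open>y = 0\<close> that search would return \<open>x\<close>, hence the separate
  case.\<close>

lemma div_eq_Least: "(x :: nat) div y = (if y = 0 then 0 else LEAST q. x \<le> q \<or> x < Suc q * y)"
proof (cases "y = 0")
  case False
  have "(LEAST q. x \<le> q \<or> x < Suc q * y) = x div y"
  proof (rule Least_equality)
    show "x \<le> x div y \<or> x < Suc (x div y) * y"
      using False by (metis dividend_less_div_times mult_Suc gr0I add.commute)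
    show "x div y \<le> q" if "x \<le> q \<or> x < Suc q * y" for q
      using that
    proof
      assume "x \<le> q" then show ?thesis using div_le_dividend order.trans by blast
    next
      assume "x < Suc q * y" then show ?thesis by (simp add: less_mult_imp_div_less flip: less_Suc_eq_le)
    qed
  qed
  with False show ?thesis by simp
qed simp

lemma rec_op_div:
  assumes F: "rec_op k F" and G: "rec_op k G"
  shows "rec_op k (\<lambda>\<phi> xs. F \<phi> xs div G \<phi> xs)"
  unfolding div_eq_Least
  by (intro rec_op_if rec_op_eq rec_op_least rec_op_disj rec_op_le rec_op_less rec_op_mult
      rec_op_Suc rec_op_const rec_op_hd F G F[THEN rec_op_weaken] G[THEN rec_op_weaken])

lemma rec_op_mod:
  assumes F: "rec_op k F" and G: "rec_op k G"
  shows "rec_op k (\<lambda>\<phi> xs. F \<phi> xs mod G \<phi> xs)"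
  unfolding modulo_nat_def by (intro rec_op_diff rec_op_mult rec_op_div F G)

lemmas rec_op_arith = rec_op_const rec_op_Suc rec_op_add rec_op_mult rec_op_power rec_op_diff
  rec_op_div rec_op_mod rec_op_query rec_op_if
lemmas rec_op_logic = rec_op_le rec_op_less rec_op_eq rec_op_not rec_op_conj rec_op_imp rec_op_disj
  rec_op_ball rec_op_bex rec_op_least
lemmas rec_op_vars = rec_op_hd rec_op_hd_tl
lemmas rec_op_intros = rec_op_arith rec_op_logic rec_op_vars

section \<open>The pairing function and its inverses\<close>

lemma rec_op_prod_encode:
  assumes F: "rec_op k F" and G: "rec_op k G"
  shows "rec_op k (\<lambda>\<phi> xs. prod_encode (F \<phi> xs, G \<phi> xs))"
  unfolding prod_encode_def triangle_def case_prod_conv by (intro rec_op_intros F G)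

text \<open>Both components of a pair are at most its code, so a search bounded by the code inverts
  the pairing.\<close>

lemma fst_prod_decode_eq_Least:
  "fst (prod_decode z) = (LEAST a. z \<le> a \<or> (\<exists>b<Suc z. prod_encode (a, b) = z))"
proof (rule Least_equality[symmetric])
  obtain a b where z: "z = prod_encode (a, b)" by (metis prod_decode_inverse surj_pair)
  show "z \<le> fst (prod_decode z) \<or> (\<exists>b<Suc z. prod_encode (fst (prod_decode z), b) = z)"
    using le_prod_encode_2[of b a] by (auto simp: z less_Suc_eq_le)
  show "fst (prod_decode z) \<le> a'" if "z \<le> a' \<or> (\<exists>b<Suc z. prod_encode (a', b) = z)" for a'
    using that le_prod_encode_1[of a b] by (auto simp: z prod_encode_eq)
qed

lemma snd_prod_decode_eq_Least:
  "snd (prod_decode z) = (LEAST b. z \<le> b \<or> (\<exists>a<Suc z. prod_encode (a, b) = z))"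
proof (rule Least_equality[symmetric])
  obtain a b where z: "z = prod_encode (a, b)" by (metis prod_decode_inverse surj_pair)
  show "z \<le> snd (prod_decode z) \<or> (\<exists>a<Suc z. prod_encode (a, snd (prod_decode z)) = z)"
    using le_prod_encode_1[of a b] by (auto simp: z less_Suc_eq_le)
  show "snd (prod_decode z) \<le> b'" if "z \<le> b' \<or> (\<exists>a<Suc z. prod_encode (a, b') = z)" for b'
    using that le_prod_encode_2[of b a] by (auto simp: z prod_encode_eq)
qed

lemma rec_op_fst_prod_decode:
  assumes F: "rec_op k F"
  shows "rec_op k (\<lambda>\<phi> xs. fst (prod_decode (F \<phi> xs)))"
  unfolding fst_prod_decode_eq_Least
  by (intro rec_op_intros rec_op_prod_encode F F[THEN rec_op_weaken] F[THEN rec_op_weaken2])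

lemma rec_op_snd_prod_decode:
  assumes F: "rec_op k F"
  shows "rec_op k (\<lambda>\<phi> xs. snd (prod_decode (F \<phi> xs)))"
  unfolding snd_prod_decode_eq_Least
  by (intro rec_op_intros rec_op_prod_encode F F[THEN rec_op_weaken] F[THEN rec_op_weaken2])

lemmas rec_op_pair = rec_op_prod_encode rec_op_fst_prod_decode rec_op_snd_prod_decode

section \<open>Strings as list codes\<close>

text \<open>A nonempty list is coded by the successor of the code of the pair (head, code of tail),
  and the empty list by 0.\<close>

definition hd_code :: "nat \<Rightarrow> nat" where
  "hd_code c = fst (prod_decode (c - 1))"

definition tl_code :: "nat \<Rightarrow> nat" where
  "tl_code c = snd (prod_decode (c - 1))"

definition drop_code :: "nat \<Rightarrow> nat \<Rightarrow> nat" where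
  "drop_code k c = rec_nat c (\<lambda>_. tl_code) k"

lemma tl_code_list_encode: "tl_code (list_encode xs) = list_encode (tl xs)"
proof (cases xs)
  case Nil
  \<comment> \<open>The code 0 of the empty list decodes to the pair of zeros, so the empty list is
    its own tail and \<open>drop_code\<close> may run past the end.\<close>
  have "prod_decode 0 = (0, 0)" using prod_encode_inverse[of "(0, 0)"] by (simp add: prod_encode_def)
  with Nil show ?thesis by (simp add: tl_code_def)
qed (simp add: tl_code_def)

lemma drop_code_list_encode: "drop_code k (list_encode xs) = list_encode (drop k xs)"
  by (induction k) (auto simp: drop_code_def tl_code_list_encode tl_drop drop_Suc)

lemma hd_code_list_encode: "xs \<noteq> [] \<Longrightarrow> hd_code (list_encode xs) = hd xs"
  by (cases xs) (auto simp: hd_code_def)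

lemma hd_code_0: "hd_code 0 = 0"
  using prod_encode_inverse[of "(0, 0)"] by (simp add: hd_code_def prod_encode_def)

lemma list_encode_eq_0: "list_encode xs = 0 \<longleftrightarrow> xs = []"
  by (cases xs) auto

lemma length_le_list_encode: "length xs \<le> list_encode xs"
proof (induction xs)
  case (Cons x xs)
  then show ?case using le_prod_encode_2[of "list_encode xs" x] by simp
qed simp

text \<open>A list is no longer than its code, so \<open>k < c\<close> reaches every entry; past the
  end \<open>hd_code\<close> gives 0, which passes the test.\<close>

definition binary_code :: "nat \<Rightarrow> bool" where
  "binary_code c \<longleftrightarrow> (\<forall>k<c. hd_code (drop_code k c) \<le> 1)"

lemma binary_code_iff: "binary_code c \<longleftrightarrow> c \<in> range string_encode"
proof
  assume c: "binary_code c"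
  define xs where "xs = list_decode c"
  have cx: "c = list_encode xs" by (simp add: xs_def)
  have "x \<le> 1" if "x \<in> set xs" for x
  proof -
    from that obtain k where k: "k < length xs" "x = xs ! k" by (auto simp: in_set_conv_nth)
    with length_le_list_encode[of xs] have "k < c" by (simp add: cx)
    with c have "hd_code (drop_code k c) \<le> 1" by (simp add: binary_code_def)
    with k show ?thesis by (simp add: cx drop_code_list_encode hd_code_list_encode hd_drop_conv_nth)
  qed
  then have "map (of_bool \<circ> (\<lambda>x. x = 1)) xs = xs" by (intro map_idI) (auto simp: le_Suc_eq)
  then have "c = string_encode (map (\<lambda>x. x = 1) xs)" by (simp add: string_encode_def cx)
  then show "c \<in> range string_encode" by blast
next
  assume "c \<in> range string_encode"
  then obtain \<sigma> where c: "c = list_encode (map of_bool \<sigma>)" by (auto simp: string_encode_def)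
  have "hd_code (drop_code k c) \<le> 1" for k
    by (cases "k < length \<sigma>")
      (auto simp: c drop_code_list_encode hd_code_list_encode hd_drop_conv_nth hd_code_0)
  then show "binary_code c" by (simp add: binary_code_def)
qed

text \<open>\<open>drop_code k c \<noteq> 0\<close> says that \<open>k\<close> is less than the
  length of the string, and \<open>a div 2 ^ i mod 2\<close> tells whether \<open>i\<close> lies in
  \<open>set_decode a\<close>.\<close>

definition code_occurs_at :: "nat \<Rightarrow> nat \<Rightarrow> nat \<Rightarrow> nat \<Rightarrow> bool" where
  "code_occurs_at c n a i \<longleftrightarrow>
     (\<forall>k<c. drop_code k c \<noteq> 0 \<longrightarrow> hd_code (drop_code k c) = a div 2 ^ ((i + k) mod n) mod 2)"

lemma code_occurs_at_iff:
  "code_occurs_at (string_encode \<sigma>) n a i \<longleftrightarrow> occurs_at \<sigma> n (set_decode a) i"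
proof -
  let ?c = "string_encode \<sigma>"
  have len: "length \<sigma> \<le> ?c" using length_le_list_encode[of "map of_bool \<sigma>"] by (simp add: string_encode_def)
  have ne: "drop_code k ?c \<noteq> 0 \<longleftrightarrow> k < length \<sigma>" for k
    by (auto simp: string_encode_def drop_code_list_encode list_encode_eq_0)
  have hd: "hd_code (drop_code k ?c) = of_bool (\<sigma> ! k)" if "k < length \<sigma>" for k
    using that by (simp add: string_encode_def drop_code_list_encode hd_code_list_encode hd_drop_conv_nth)
  have bit: "(of_bool b = x mod (2::nat)) = (b = odd x)" for b x by (cases b) (auto simp: odd_iff_mod_2_eq_one)
  show ?thesis unfolding code_occurs_at_def occurs_at_def ne set_decode_def
    using len by (auto simp: hd bit)
qed

definition code_count :: "nat \<Rightarrow> nat \<Rightarrow> nat \<Rightarrow> nat" where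
  "code_count n a c = (\<Sum>i<n. of_bool (code_occurs_at c n a i))"

lemma code_count_eq: "code_count n a (string_encode \<sigma>) = occ_count n (set_decode a) \<sigma>"
  by (simp add: code_count_def occ_count_def code_occurs_at_iff sum_of_bool_eq Int_def)

lemma rec_op_hd_code: "rec_op k F \<Longrightarrow> rec_op k (\<lambda>\<phi> xs. hd_code (F \<phi> xs))"
  unfolding hd_code_def by (intro rec_op_intros rec_op_pair)

lemma rec_op_tl_code: "rec_op k F \<Longrightarrow> rec_op k (\<lambda>\<phi> xs. tl_code (F \<phi> xs))"
  unfolding tl_code_def by (intro rec_op_intros rec_op_pair)

lemma rec_op_drop_code:
  assumes F: "rec_op k F" and G: "rec_op k G"
  shows "rec_op k (\<lambda>\<phi> xs. drop_code (F \<phi> xs) (G \<phi> xs))"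
  unfolding drop_code_def by (intro rec_op_rec_nat rec_op_tl_code rec_op_vars F G)

lemma rec_op_binary_code:
  assumes F: "rec_op k F"
  shows "rec_op k (\<lambda>\<phi> xs. of_bool (binary_code (F \<phi> xs)))"
  unfolding binary_code_def
  by (intro rec_op_intros rec_op_hd_code rec_op_drop_code F F[THEN rec_op_weaken])

lemma rec_op_code_count:
  assumes N: "rec_op k N" and A: "rec_op k A" and C: "rec_op k C"
  shows "rec_op k (\<lambda>\<phi> xs. code_count (N \<phi> xs) (A \<phi> xs) (C \<phi> xs))"
  unfolding code_count_def code_occurs_at_def
  by (intro rec_op_sum rec_op_intros rec_op_hd_code rec_op_drop_code N
      N[THEN rec_op_weaken2] A[THEN rec_op_weaken2]
      C[THEN rec_op_weaken] C[THEN rec_op_weaken2])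

section \<open>Good approximations exist\<close>

lemma cylinder_at_measurable: "{\<omega>. \<forall>k<length \<sigma>. \<omega> (r + k) = \<sigma> ! k} \<in> sets (borel :: (nat \<Rightarrow> bool) measure)"
proof -
  have "(\<lambda>\<omega> :: nat \<Rightarrow> bool. \<omega> i) \<in> borel_measurable borel" for i
    by (rule borel_measurable_continuous_onI) (rule continuous_on_product_coordinates)
  then have "{\<omega>. \<omega> i = b} \<in> sets (borel :: (nat \<Rightarrow> bool) measure)" for i b
    using measurable_sets_borel[of "\<lambda>\<omega>. \<omega> i" borel "{b}"] by (simp add: vimage_def)
  then have "(\<Inter>k<length \<sigma>. {\<omega>. \<omega> (r + k) = \<sigma> ! k}) \<in> sets (borel :: (nat \<Rightarrow> bool) measure)"
    by (cases "length \<sigma> = 0") (auto intro!: sets.finite_INT)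
  then show ?thesis by (simp add: INTER_eq)
qed

context
  fixes \<mu> :: "(nat \<Rightarrow> bool) measure"
  assumes inv: "shift_invariant_measure \<mu>"
begin

interpretation prob_space \<mu>
  using inv by (simp add: shift_invariant_measure_def)

text \<open>The preimage under the shift of the event at position \<open>r\<close> is the event at
  position \<open>r + 1\<close>, so invariance carries the measure along by induction.\<close>

lemma measure_cylinder_at:
  "measure \<mu> {\<omega>. \<forall>k<length \<sigma>. \<omega> (r + k) = \<sigma> ! k} = measure \<mu> (cylinder \<sigma>)"
proof (induction r)
  case 0 show ?case by (simp add: cylinder_def)
next
  case (Suc r)
  let ?S = "\<lambda>r. {\<omega> :: nat \<Rightarrow> bool. \<forall>k<length \<sigma>. \<omega> (r + k) = \<sigma> ! k}"
  have "emeasure \<mu> (shift -` ?S r) = emeasure \<mu> (?S r)"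
    using inv cylinder_at_measurable[of \<sigma> r] unfolding shift_invariant_measure_def by blast
  moreover have "shift -` ?S r = ?S (Suc r)" by (auto simp: shift_def)
  ultimately show ?case using Suc by (simp add: measure_def)
qed

text \<open>Cylinders of distinct words of length \<open>M\<close> are disjoint, and those of words
  showing \<open>\<sigma>\<close> at offset \<open>r\<close> partition the event that
  \<open>\<sigma>\<close> stands at position \<open>r\<close>.\<close>

lemma sum_cylinders:
  assumes "r + length \<sigma> \<le> M"
  shows "(\<Sum>w | length w = M \<and> (\<forall>k<length \<sigma>. w ! (r + k) = \<sigma> ! k). measure \<mu> (cylinder w))
    = measure \<mu> (cylinder \<sigma>)"
proof -
  let ?W = "{w. length w = M \<and> (\<forall>k<length \<sigma>. w ! (r + k) = \<sigma> ! k)}"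
  have "finite {w :: bool list. length w = M}" using finite_lists_length_eq[of "UNIV :: bool set" M] by simp
  then have fin: "finite ?W" by (rule rev_finite_subset) auto
  have "measure \<mu> (\<Union>w\<in>?W. cylinder w) = (\<Sum>w\<in>?W. measure \<mu> (cylinder w))"
  proof (rule finite_measure_finite_Union[OF fin])
    have "cylinder w \<in> sets borel" for w
      using cylinder_at_measurable[of w 0] by (simp add: cylinder_def)
    then show "cylinder ` ?W \<subseteq> sets \<mu>" using inv by (auto simp: shift_invariant_measure_def)
    show "disjoint_family_on cylinder ?W"
      by (auto simp: disjoint_family_on_def cylinder_def intro: nth_equalityI)
  qed
  moreover have "(\<Union>w\<in>?W. cylinder w) = {\<omega>. \<forall>k<length \<sigma>. \<omega> (r + k) = \<sigma> ! k}"
  proof (intro set_eqI iffI)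
    fix \<omega> assume "\<omega> \<in> {\<omega>. \<forall>k<length \<sigma>. \<omega> (r + k) = \<sigma> ! k}"
    with assms have "map \<omega> [0..<M] \<in> ?W" "\<omega> \<in> cylinder (map \<omega> [0..<M])"
      by (auto simp: cylinder_def)
    then show "\<omega> \<in> (\<Union>w\<in>?W. cylinder w)" by blast
  qed (use assms in \<open>auto simp: cylinder_def\<close>)
  ultimately show ?thesis using measure_cylinder_at by simp
qed

end

text \<open>
  Cut a \<open>\<mu>\<close>-random sequence into blocks of length \<open>M\<close>, and let each block \<open>w\<close> occur
  \<open>\<lfloor>K \<mu>[w]\<rfloor>\<close> times, where \<open>K = n div M\<close>; the word is padded with zeros up to length \<open>n\<close>. By
  shift invariance each position inside a block contributes the right
  frequency of \<open>\<sigma>\<close>; the positions at block boundaries and in the padding are few.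
\<close>

lemma block_word_exists:
  fixes \<mu> :: "(nat \<Rightarrow> bool) measure"
  assumes inv: "shift_invariant_measure \<mu>" and "0 < M" "L \<le> M"
  shows "\<exists>A \<subseteq> {..<n}. \<forall>\<sigma>. length \<sigma> \<le> L \<longrightarrow>
    \<bar>real (occ_count n A \<sigma>) - real n * measure \<mu> (cylinder \<sigma>)\<bar> \<le> 2 * real M * 2 ^ M + real n * real L / real M"
proof -
  interpret prob_space \<mu> using inv by (simp add: shift_invariant_measure_def)
  define p where "p w = measure \<mu> (cylinder w)" for w
  define K where "K = n div M"
  define c where "c w = nat \<lfloor>real K * p w\<rfloor>" for w
  define W where "W = {w :: bool list. length w = M}"
  have finW: "finite W" and cardW: "card W = 2 ^ M"
    using finite_lists_length_eq[of "UNIV :: bool set" M] card_lists_length_eq[of "UNIV :: bool set" M]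
    by (simp_all add: W_def)
  have p: "0 \<le> p w" "p w \<le> 1" for w by (auto simp: p_def)
  have c: "real (c w) \<le> real K * p w" "real K * p w \<le> real (c w) + 1" for w
    using p[of w] unfolding c_def by (simp_all add: of_nat_floor)
  have sum_p: "(\<Sum>w\<in>W. p w) = 1"
  proof -
    have "(\<Sum>w\<in>W. p w) = p []" using sum_cylinders[OF inv, of 0 "[]" M] by (simp add: W_def p_def)
    also have "\<dots> = 1"
      using prob_space inv sets_eq_imp_space_eq[of \<mu> borel]
      by (simp add: p_def cylinder_def shift_invariant_measure_def)
    finally show ?thesis .
  qed
  obtain vs where vs: "set vs = W" "distinct vs" using finite_distinct_list[OF finW] by blast
  define ws where "ws = concat (map (\<lambda>w. replicate (c w) w) vs)"
  have sum_ws: "(\<Sum>q<length ws. F (ws ! q)) = (\<Sum>w\<in>W. c w * F w)" for F :: "bool list \<Rightarrow> nat"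
  proof -
    have "(\<Sum>q<length ws. F (ws ! q)) = sum_list (map F ws)"
      by (simp add: sum_list_sum_nth atLeast0LessThan)
    also have "\<dots> = sum_list (map (\<lambda>w. c w * F w) vs)"
      unfolding ws_def by (induction vs) (auto simp: sum_list_replicate)
    also have "\<dots> = (\<Sum>w\<in>W. c w * F w)" using vs by (simp add: sum_list_distinct_conv_sum_set)
    finally show ?thesis .
  qed
  define K' where "K' = length ws"
  have "K' = (\<Sum>w\<in>W. c w)" using sum_ws[of "\<lambda>_. 1"] by (simp add: K'_def)
  then have rK': "real K' = (\<Sum>w\<in>W. real (c w))" by simp
  have "real K' \<le> (\<Sum>w\<in>W. real K * p w)" unfolding rK' by (intro sum_mono c)
  then have K'le: "K' \<le> K" by (simp add: sum_p flip: sum_distrib_left)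
  \<comment> \<open>Rounding down loses at most one block for each of the \<open>2 ^ M\<close>
    words.\<close>
  have "(\<Sum>w\<in>W. real K * p w) \<le> (\<Sum>w\<in>W. real (c w) + 1)" by (intro sum_mono c)
  then have K'ge: "real K \<le> real K' + 2 ^ M"
    by (simp add: sum_p rK' sum.distrib cardW flip: sum_distrib_left)
  have len: "length (ws ! q) = M" if "q < K'" for q
  proof -
    have "ws ! q \<in> set ws" using that by (simp add: K'_def)
    then show ?thesis using vs by (auto simp: ws_def W_def split: if_splits)
  qed
  have KMn: "M * K \<le> n" by (simp add: K_def)
  have nKM: "n \<le> M * K + M"
    using mod_less_divisor[OF \<open>0 < M\<close>, of n] mult_div_mod_eq[of M n] unfolding K_def by linarith
  have K'Mn: "M * K' \<le> n" using K'le KMn by (meson mult_le_mono2 order.trans)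
  \<comment> \<open>Bit \<open>i\<close> is read off block \<open>i div M\<close> at place
    \<open>i mod M\<close>; the restriction \<open>i < M * K'\<close> produces the zero
    padding.\<close>
  define A where "A = {i. i < M * K' \<and> ws ! (i div M) ! (i mod M)}"
  have pos_less: "M * q + s < M * K'" if "q < K'" "s < M" for q s
  proof -
    have "M * q + s < M * (q + 1)" using that by simp
    also have "\<dots> \<le> M * K'" using that by (intro mult_le_mono2) simp
    finally show ?thesis .
  qed
  have AI: "M * q + s \<in> A \<longleftrightarrow> ws ! q ! s" if "q < K'" "s < M" for q s
    using pos_less[OF that] that by (simp add: A_def)
  show ?thesis
  proof (intro exI[of _ A] conjI allI impI)
    show "A \<subseteq> {..<n}" using K'Mn by (auto simp: A_def)
    fix \<sigma> :: "bool list" assume "length \<sigma> \<le> L"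
    \<comment> \<open>For \<open>r < R\<close> an occurrence at offset \<open>r\<close> stays inside
      its block. The offset \<open>R\<close> is left out, so that \<open>r < M\<close> holds for the
      empty string as well and \<open>pos\<close> is injective.\<close>
    define R where "R = M - length \<sigma>"
    define match where "match w r \<longleftrightarrow> (\<forall>k<length \<sigma>. w ! (r + k) = \<sigma> ! k)" for w r
    define F where "F w = (\<Sum>r<R. of_bool (match w r) :: nat)" for w
    define pos where "pos = (\<lambda>(q, r). M * q + r)"
    define X where "X = {..<K'} \<times> {..<R}"
    define occ where "occ = {i. i < n \<and> occurs_at \<sigma> n A i}"
    have rk: "r + k < M" if "r < R" "k < length \<sigma>" for r k
      using that by (simp add: R_def)
    have RM: "R \<le> M" "M \<le> R + L" using \<open>length \<sigma> \<le> L\<close> by (auto simp: R_def)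
    have inj: "inj_on pos X"
    proof (rule inj_onI)
      fix x y assume xy: "x \<in> X" "y \<in> X" "pos x = pos y"
      obtain q r q' r' where [simp]: "x = (q, r)" "y = (q', r')" by (metis surj_pair)
      from xy RM have "r < M" "r' < M" and eq: "M * q + r = M * q' + r'" by (auto simp: X_def pos_def)
      have "r = r'" using arg_cong[OF eq, of "\<lambda>i. i mod M"] \<open>r < M\<close> \<open>r' < M\<close> by simp
      moreover have "q = q'" using arg_cong[OF eq, of "\<lambda>i. i div M"] \<open>r < M\<close> \<open>r' < M\<close> by simp
      ultimately show "x = y" by simp
    qed
    have pos_n: "pos ` X \<subseteq> {..<n}"
    proof
      fix i assume "i \<in> pos ` X"
      then obtain q r where "i = M * q + r" "q < K'" "r < R" by (auto simp: X_def pos_def)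
      then show "i \<in> {..<n}" using pos_less[of q r] RM K'Mn by simp
    qed
    have occ_pos: "pos x \<in> occ \<longleftrightarrow> match (ws ! fst x) (snd x)" if "x \<in> X" for x
    proof -
      obtain q r where x: "x = (q, r)" "q < K'" "r < R" using \<open>x \<in> X\<close> by (auto simp: X_def)
      have "(pos x + k) mod n \<in> A \<longleftrightarrow> ws ! q ! (r + k)" if "k < length \<sigma>" for k
      proof -
        have "M * q + (r + k) < M * K'" using pos_less[OF x(2) rk[OF x(3) that]] .
        then have "(pos x + k) mod n = M * q + (r + k)" using K'Mn by (simp add: pos_def x add.assoc)
        then show ?thesis using AI[OF x(2) rk[OF x(3) that]] by simp
      qed
      moreover have "pos x < n" using pos_n \<open>x \<in> X\<close> by blast
      ultimately show ?thesis by (auto simp: occ_def occurs_at_def match_def x)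
    qed
    \<comment> \<open>Occurrences starting at these offsets are counted exactly: each word
      contributes its multiplicity times its number of matching offsets.\<close>
    have "card (occ \<inter> pos ` X) = card {x \<in> X. match (ws ! fst x) (snd x)}"
    proof -
      have "occ \<inter> pos ` X = pos ` {x \<in> X. match (ws ! fst x) (snd x)}" using occ_pos by auto
      then show ?thesis using inj by (simp add: card_image inj_on_subset)
    qed
    also have "\<dots> = (\<Sum>x\<in>X. of_bool (match (ws ! fst x) (snd x)))"
      by (simp add: X_def sum_of_bool_eq Int_def)
    also have "\<dots> = (\<Sum>q<K'. F (ws ! q))"
      by (simp add: X_def F_def sum.cartesian_product case_prod_unfold del: sum_of_bool_eq)
    also have "\<dots> = (\<Sum>w\<in>W. c w * F w)" unfolding K'_def by (rule sum_ws)
    finally have good: "card (occ \<inter> pos ` X) = (\<Sum>w\<in>W. c w * F w)" .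
    \<comment> \<open>At all other positions nothing is known, so they are bounded by their
      number.\<close>
    have "card (occ - pos ` X) \<le> card ({..<n} - pos ` X)"
      by (rule card_mono) (auto simp: occ_def)
    also have "\<dots> = n - card (pos ` X)" using pos_n by (simp add: card_Diff_subset finite_subset)
    also have "card (pos ` X) = K' * R" using inj by (simp add: card_image X_def)
    finally have bad: "card (occ - pos ` X) \<le> n - K' * R" .
    have "K' * R \<le> M * K'" using RM by simp
    then have K'Rn: "K' * R \<le> n" using K'Mn by linarith
    have "finite occ" by (simp add: occ_def)
    then have N: "occ_count n A \<sigma> = card (occ \<inter> pos ` X) + card (occ - pos ` X)"
      using card_Un_disjoint[of "occ \<inter> pos ` X" "occ - pos ` X"]
      by (simp add: occ_count_def occ_def[symmetric] Int_Diff_Un Int_Diff_disjoint)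
    define S where "S = (\<Sum>w\<in>W. real (c w) * real (F w))"
    have NS: "S \<le> occ_count n A \<sigma>" "occ_count n A \<sigma> \<le> S + real n - real K' * real R"
      using bad K'Rn unfolding N good S_def by (simp_all add: of_nat_diff flip: of_nat_mult)
    \<comment> \<open>After exchanging the sums, \<open>sum_cylinders\<close> gives each offset
      \<open>r\<close> the same total weight \<open>p \<sigma>\<close>.\<close>
    have pF: "(\<Sum>w\<in>W. p w * real (F w)) = real R * p \<sigma>"
    proof -
      have "(\<Sum>w\<in>W. p w * real (F w)) = (\<Sum>r<R. \<Sum>w\<in>W. p w * of_bool (match w r))"
        unfolding F_def by (subst sum.swap) (simp add: sum_distrib_left mult.commute)
      also have "\<dots> = (\<Sum>r<R. p \<sigma>)"
      proof (rule sum.cong[OF refl])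
        fix r assume "r \<in> {..<R}"
        then have "r + length \<sigma> \<le> M" by (simp add: R_def)
        from sum_cylinders[OF inv this] show "(\<Sum>w\<in>W. p w * of_bool (match w r)) = p \<sigma>"
          using finW by (simp add: W_def match_def p_def Int_def)
      qed
      finally show ?thesis by simp
    qed
    have "S \<le> (\<Sum>w\<in>W. real K * p w * real (F w))"
      unfolding S_def by (intro sum_mono mult_right_mono c) simp
    then have S_le: "S \<le> real K * real R * p \<sigma>"
      by (simp add: pF mult.assoc flip: sum_distrib_left)
    have F_le: "F w \<le> R" for w
      unfolding F_def by (simp add: sum_of_bool_eq) (metis card_lessThan card_mono finite_lessThan inf_le1)
    have "real K * real R * p \<sigma> = (\<Sum>w\<in>W. real K * p w * real (F w))"
      by (simp add: pF mult.assoc flip: sum_distrib_left)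
    also have "\<dots> \<le> (\<Sum>w\<in>W. (real (c w) + 1) * real (F w))"
      by (intro sum_mono mult_right_mono c) simp
    also have "\<dots> = S + (\<Sum>w\<in>W. real (F w))"
      by (simp add: S_def distrib_right sum.distrib)
    also have "(\<Sum>w\<in>W. real (F w)) \<le> (\<Sum>w\<in>W. real M)"
      by (intro sum_mono) (use F_le RM in \<open>meson of_nat_mono order.trans\<close>)
    finally have S_ge: "real K * real R * p \<sigma> \<le> S + 2 ^ M * real M" by (simp add: cardW)
    define E where "E = real n - real K * real R"
    have "K * R \<le> M * K" using RM by simp
    with KMn have "real (K * R) \<le> real n" by (subst of_nat_le_iff) linarith
    then have "0 \<le> E" by (simp add: E_def)
    \<comment> \<open>\<open>E\<close> consists of the part of \<open>n\<close> beyond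
      \<open>K\<close> full blocks, at most \<open>M\<close>, and of the at most \<open>L\<close>
      offsets given up in each of these blocks.\<close>
    have E_le: "E \<le> real M + real n * real L / real M"
    proof -
      have "real n \<le> real K * real M + real M" using nKM by (metis mult.commute of_nat_add of_nat_le_iff of_nat_mult)
      moreover have "real K * real M \<le> real K * (real R + real L)"
        using RM by (intro mult_left_mono) (simp_all flip: of_nat_add)
      moreover have "real K \<le> real n / real M" by (simp add: K_def of_nat_div_le_of_nat)
      then have "real K * real L \<le> real n / real M * real L" by (rule mult_right_mono) simp
      ultimately show ?thesis by (simp add: E_def algebra_simps)
    qed
    have Ep: "0 \<le> E * p \<sigma>" "E * p \<sigma> \<le> E" using p[of \<sigma>] \<open>0 \<le> E\<close> by (auto simp: mult_left_le)
    have "(real K - real K') * real R \<le> 2 ^ M * real M"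
      using K'ge K'le RM by (intro mult_mono) auto
    then have KK': "real K * real R - real K' * real R \<le> 2 ^ M * real M" by (simp add: algebra_simps)
    have pow: "real M \<le> 2 ^ M * real M" using mult_right_mono[of 1 "2 ^ M" "real M"] by simp
    have np: "real n * p \<sigma> = E * p \<sigma> + real K * real R * p \<sigma>" by (simp add: E_def algebra_simps)
    \<comment> \<open>From below, rounding costs \<open>2 ^ M * M\<close> and the positions in
      \<open>E\<close> cost \<open>E * p \<sigma> \<le> E\<close>. From above, the unknown positions
      number \<open>n - K' * R\<close>, which is \<open>E\<close> plus at most
      \<open>2 ^ M * M\<close> for the missing blocks.\<close>
    have "\<bar>real (occ_count n A \<sigma>) - real n * p \<sigma>\<bar> \<le> E + 2 ^ M * real M"
      using NS S_le S_ge Ep KK' np E_def by linarith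
    also have "\<dots> \<le> 2 * real M * 2 ^ M + real n * real L / real M"
      using E_le pow by (simp add: mult.commute)
    finally show "\<bar>real (occ_count n A \<sigma>) - real n * measure \<mu> (cylinder \<sigma>)\<bar>
        \<le> 2 * real M * 2 ^ M + real n * real L / real M"
      by (simp add: p_def)
  qed
qed

section \<open>The two algorithms\<close>

text \<open>
  For the code \<open>r\<close> of a rational \<open>x\<close>, the integer part of \<open>n\<close> times the positive part of \<open>x\<close>: \<open>int_encode\<close> sends
  the nonnegative integers to the even numbers.
\<close>

definition scaled_code :: "nat \<Rightarrow> nat \<Rightarrow> nat" where
  "scaled_code r n =
     (if fst (prod_decode r) mod 2 = 0 then fst (prod_decode r) div 2 else 0) * n div snd (prod_decode r)"

lemma scaled_code_rat_encode:
  "\<bar>real (scaled_code (rat_encode x) n) - real n * max 0 (of_rat x)\<bar> \<le> 1"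
proof -
  obtain p q where pq: "quotient_of x = (p, q)" by (metis surj_pair)
  have q: "q > 0" using quotient_of_denom_pos[OF pq] .
  have x: "of_rat x = real_of_int p / real_of_int q"
    using quotient_of_div[OF pq] by (simp add: of_rat_divide)
  have "scaled_code (rat_encode x) n = nat p * n div nat q"
    using pq by (auto simp: scaled_code_def rat_encode_def int_encode_def sum_encode_def)
  moreover have "real n * max 0 (of_rat x) = real (nat p * n) / real (nat q)"
    using q by (cases "0 \<le> p") (auto simp: x max_def divide_le_0_iff zero_le_divide_iff)
  moreover have "\<bar>real (a div b) - real a / real b\<bar> \<le> 1" for a b :: nat
  proof -
    have "real (a div b) = of_int \<lfloor>real a / real b\<rfloor>"
      by (simp only: floor_divide_of_nat_eq of_int_of_nat_eq)
    then show ?thesis using floor_correct[of "real a / real b"] by linarith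
  qed
  ultimately show ?thesis by (simp only:)
qed

text \<open>
  The bound \<open>n / k\<close> on the error in the count corresponds to the error \<open>1 / k\<close> in the density. The
  guard \<open>binary_code c\<close> makes the test independent of the oracle's answers off the codes of strings.
\<close>

definition code_close :: "(nat \<Rightarrow> nat) \<Rightarrow> nat \<Rightarrow> nat \<Rightarrow> nat \<Rightarrow> bool" where
  "code_close \<phi> n k a \<longleftrightarrow> (\<forall>c<k. binary_code c \<longrightarrow>
     k * ((scaled_code (\<phi> (prod_encode (c, n))) n - code_count n a c)
        + (code_count n a c - scaled_code (\<phi> (prod_encode (c, n))) n)) \<le> n)"

text \<open>
  \<open>code_close \<phi> n k a\<close> gets stronger as \<open>k\<close> grows, so a code that is close at the largest
  attainable level is close at every attainable level, and the search succeeds below \<open>2\<^sup>n\<close>.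
\<close>

definition best_code :: "(nat \<Rightarrow> nat) \<Rightarrow> nat \<Rightarrow> nat" where
  "best_code \<phi> n = (LEAST a. 2 ^ n \<le> a \<or>
     (\<forall>k<n. (\<exists>a'<2 ^ n. code_close \<phi> n k a') \<longrightarrow> code_close \<phi> n k a))"

lemma rec_op_code_close:
  assumes N: "rec_op l N" and K: "rec_op l K" and A: "rec_op l A"
  shows "rec_op l (\<lambda>\<phi> xs. of_bool (code_close \<phi> (N \<phi> xs) (K \<phi> xs) (A \<phi> xs)))"
  unfolding code_close_def scaled_code_def
  by (intro rec_op_intros rec_op_pair rec_op_binary_code rec_op_code_count
      K N[THEN rec_op_weaken] K[THEN rec_op_weaken] A[THEN rec_op_weaken])

lemma rec_op_best_code:
  assumes N: "rec_op l N"
  shows "rec_op l (\<lambda>\<phi> xs. best_code \<phi> (N \<phi> xs))"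
  unfolding best_code_def
  by (intro rec_op_intros rec_op_code_close rec_op_hd_tl[THEN rec_op_weaken] N N[THEN rec_op_weaken] N[THEN rec_op_weaken2]
      N[THEN rec_op_weaken2, THEN rec_op_weaken])

section \<open>Correctness of the search over subsets\<close>

definition close_counts :: "(bool list \<times> nat \<Rightarrow> rat) \<Rightarrow> nat \<Rightarrow> nat \<Rightarrow> nat set \<Rightarrow> bool" where
  "close_counts f n k A \<longleftrightarrow> (\<forall>\<sigma>. string_encode \<sigma> < k \<longrightarrow>
     real k * \<bar>real (scaled_code (rat_encode (f (\<sigma>, n))) n) - real (occ_count n A \<sigma>)\<bar> \<le> real n)"

lemma close_counts_mono: "close_counts f n k A \<Longrightarrow> k' \<le> k \<Longrightarrow> close_counts f n k' A"
  unfolding close_counts_def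
  by (meson abs_ge_zero less_le_trans mult_right_mono of_nat_mono order.trans)

text \<open>All answers that affect the test are values of \<open>f\<close>, so the test, and with
  it the set found by the search, is the same for every oracle for \<open>f\<close>.\<close>

lemma code_close_iff:
  assumes "oracle_for \<phi> UNIV query_encode rat_encode f"
  shows "code_close \<phi> n k a \<longleftrightarrow> close_counts f n k (set_decode a)"
proof -
  have \<phi>: "\<phi> (prod_encode (string_encode \<sigma>, n)) = rat_encode (f (\<sigma>, n))" for \<sigma>
    using assms by (auto simp: oracle_for_def query_encode_def)
  \<comment> \<open>One of the two truncated differences is 0, so their sum is the absolute
    difference.\<close>
  have diff: "(k * ((x - y) + (y - x)) \<le> n) = (real k * \<bar>real x - real y\<bar> \<le> real n)" for x y :: nat
  proof -
    have "\<bar>real x - real y\<bar> = real ((x - y) + (y - x))" by linarith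
    then have "real k * \<bar>real x - real y\<bar> = real (k * ((x - y) + (y - x)))" by simp
    then show ?thesis by (simp only: of_nat_le_iff)
  qed
  show ?thesis
    unfolding code_close_def close_counts_def diff binary_code_iff
    by (auto simp: \<phi> code_count_eq)
qed

lemma set_encode_less: "A \<subseteq> {..<n} \<Longrightarrow> set_encode A < 2 ^ n"
proof -
  assume "A \<subseteq> {..<n}"
  then have "set_encode A \<le> (\<Sum>i<n. 2 ^ i)" unfolding set_encode_def by (intro sum_mono2) auto
  also have "\<dots> < 2 ^ n" by (induction n) auto
  finally show ?thesis .
qed

lemma set_decode_subset: "a < 2 ^ n \<Longrightarrow> set_decode a \<subseteq> {..<n}"
proof
  fix i assume "a < 2 ^ n" "i \<in> set_decode a"
  then have "\<not> a < 2 ^ i" by (auto simp: set_decode_def)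
  with \<open>a < 2 ^ n\<close> have "2 ^ i < (2 :: nat) ^ n" by linarith
  then show "i \<in> {..<n}" by simp
qed

lemma best_code_less_close:
  assumes \<phi>: "oracle_for \<phi> UNIV query_encode rat_encode f"
  shows "best_code \<phi> n < 2 ^ n"
    and "k < n \<Longrightarrow> A \<subseteq> {..<n} \<Longrightarrow> close_counts f n k A \<Longrightarrow> close_counts f n k (set_decode (best_code \<phi> n))"
proof -
  let ?good = "\<lambda>a. \<forall>k<n. (\<exists>a'<2 ^ n. code_close \<phi> n k a') \<longrightarrow> code_close \<phi> n k a"
  let ?K = "{k. k < n \<and> (\<exists>a'<2 ^ n. code_close \<phi> n k a')}"
  have "\<exists>a<2 ^ n. ?good a"
  proof (cases "?K = {}")
    \<comment> \<open>If no level is attainable, every code passes.\<close>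
    case True then show ?thesis by (intro exI[of _ 0]) auto
  next
    case False
    have fin: "finite ?K" by simp
    from Max_in[OF fin False] obtain a where a: "a < 2 ^ n" "code_close \<phi> n (Max ?K) a" by blast
    have "code_close \<phi> n k a" if "k < n" "\<exists>a'<2 ^ n. code_close \<phi> n k a'" for k
      using close_counts_mono[of f n "Max ?K" "set_decode a" k] a(2) Max_ge[OF fin, of k] that
      by (simp add: code_close_iff[OF \<phi>])
    with a(1) show ?thesis by blast
  qed
  then obtain a where a: "a < 2 ^ n" "?good a" by blast
  have "2 ^ n \<le> best_code \<phi> n \<or> ?good (best_code \<phi> n)"
    unfolding best_code_def by (rule LeastI[where k = a]) (use a(2) in blast)
  moreover have "best_code \<phi> n \<le> a" unfolding best_code_def by (rule Least_le) (use a(2) in blast)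
  ultimately have less: "best_code \<phi> n < 2 ^ n" and good: "?good (best_code \<phi> n)"
    using a(1) by simp_all
  show "best_code \<phi> n < 2 ^ n" by (rule less)
  assume "k < n" "A \<subseteq> {..<n}" "close_counts f n k A"
  moreover from this have "code_close \<phi> n k (set_encode A)"
    using set_encode_inverse[OF finite_subset, of A "{..<n}"] by (simp add: code_close_iff[OF \<phi>])
  ultimately have "code_close \<phi> n k (best_code \<phi> n)" using good set_encode_less by blast
  then show "close_counts f n k (set_decode (best_code \<phi> n))" by (simp add: code_close_iff[OF \<phi>])
qed

text \<open>Chosen for blocks of length \<open>M = 4k\<^sup>2\<close>: then \<open>n \<ge> 8kM2\<^sup>M\<close> makes both error terms
  of \<open>block_word_exists\<close> at most \<open>n / (4k)\<close>.\<close>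

definition length_bound :: "nat \<Rightarrow> nat" where
  "length_bound k = 8 * k * (4 * k\<^sup>2) * 2 ^ (4 * k\<^sup>2)"

text \<open>It puts the level \<open>k\<close> into the range \<open>k < n\<close> of the search,
  and makes an error of 2 in the count at most \<open>n / (2 * k)\<close>.\<close>

lemma length_bound_ge:
  assumes "0 < k" shows "4 * k \<le> length_bound k"
proof -
  have "4 * k * (1 * 1) \<le> 8 * k * (4 * k\<^sup>2 * 2 ^ (4 * k\<^sup>2))"
    using assms by (intro mult_le_mono) auto
  then show ?thesis by (simp add: length_bound_def mult.assoc)
qed

text \<open>Precision \<open>n\<close> costs \<open>n / 2 ^ n \<le> 1\<close> after scaling, and
  rounding costs another 1. Replacing a negative value by 0 only brings it closer to the
  measure.\<close>

lemma scaled_code_close: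
  assumes "represents f \<mu>"
  shows "\<bar>real (scaled_code (rat_encode (f (\<sigma>, n))) n) - real n * measure \<mu> (cylinder \<sigma>)\<bar> \<le> 2"
proof -
  have "\<bar>max 0 (of_rat (f (\<sigma>, n))) - measure \<mu> (cylinder \<sigma>)\<bar> \<le> 1 / 2 ^ n"
    using assms measure_nonneg[of \<mu> "cylinder \<sigma>"] unfolding represents_def by (smt (verit))
  then have "real n * \<bar>max 0 (of_rat (f (\<sigma>, n))) - measure \<mu> (cylinder \<sigma>)\<bar> \<le> real n * (1 / 2 ^ n)"
    by (rule mult_left_mono) simp
  also have "\<dots> \<le> 1" using of_nat_less_two_power[of n, where 'a = real] by simp
  finally have "\<bar>real n * max 0 (of_rat (f (\<sigma>, n))) - real n * measure \<mu> (cylinder \<sigma>)\<bar> \<le> 1"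
    by (simp add: abs_mult flip: right_diff_distrib)
  with scaled_code_rat_encode[of "f (\<sigma>, n)" n] show ?thesis by linarith
qed

text \<open>The budget \<open>n\<close> is halved: one half pays for the block word, the other for
  the approximation by \<open>f\<close>.\<close>

lemma close_counts_exists:
  assumes inv: "shift_invariant_measure \<mu>" and f: "represents f \<mu>" and k: "0 < k" and n: "length_bound k \<le> n"
  shows "\<exists>A\<subseteq>{..<n}. close_counts f n k A"
proof -
  let ?M = "4 * k\<^sup>2"
  have "0 < ?M" "k \<le> ?M" using k by (simp_all add: power2_eq_square)
  from block_word_exists[OF inv this, of n]
  obtain A where A: "A \<subseteq> {..<n}" and dens: "\<And>\<sigma>. length \<sigma> \<le> k \<Longrightarrow>
      \<bar>real (occ_count n A \<sigma>) - real n * measure \<mu> (cylinder \<sigma>)\<bar> \<le> 2 * real ?M * 2 ^ ?M + real n * real k / real ?M"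
    by blast
  have "close_counts f n k A"
    unfolding close_counts_def
  proof (intro allI impI)
    fix \<sigma> assume \<sigma>: "string_encode \<sigma> < k"
    have "length \<sigma> \<le> k"
      using \<sigma> length_le_list_encode[of "map of_bool \<sigma>"] by (simp add: string_encode_def)
    note dens[OF this]
    then have "real k * \<bar>real (occ_count n A \<sigma>) - real n * measure \<mu> (cylinder \<sigma>)\<bar>
        \<le> real k * (2 * real ?M * 2 ^ ?M + real n * real k / real ?M)"
      by (rule mult_left_mono) simp
    also have "\<dots> = real (length_bound k) / 4 + real n / 4"
      using k by (simp add: length_bound_def field_simps power2_eq_square)
    also have "\<dots> \<le> real n / 2" using n by simp
    finally have 1: "real k * \<bar>real (occ_count n A \<sigma>) - real n * measure \<mu> (cylinder \<sigma>)\<bar> \<le> real n / 2" .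
    have "real k * \<bar>real (scaled_code (rat_encode (f (\<sigma>, n))) n) - real n * measure \<mu> (cylinder \<sigma>)\<bar> \<le> real k * 2"
      using scaled_code_close[OF f] by (rule mult_left_mono) simp
    also have "\<dots> \<le> real n / 2" using length_bound_ge[OF k] n by simp
    finally have 2: "real k * \<bar>real (scaled_code (rat_encode (f (\<sigma>, n))) n) - real n * measure \<mu> (cylinder \<sigma>)\<bar> \<le> real n / 2" .
    have "real k * \<bar>real (scaled_code (rat_encode (f (\<sigma>, n))) n) - real (occ_count n A \<sigma>)\<bar>
      \<le> real k * (\<bar>real (scaled_code (rat_encode (f (\<sigma>, n))) n) - real n * measure \<mu> (cylinder \<sigma>)\<bar>
         + \<bar>real (occ_count n A \<sigma>) - real n * measure \<mu> (cylinder \<sigma>)\<bar>)"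
      by (intro mult_left_mono) auto
    also have "\<dots> \<le> real n" using 1 2 by (simp add: distrib_left)
    finally show "real k * \<bar>real (scaled_code (rat_encode (f (\<sigma>, n))) n) - real (occ_count n A \<sigma>)\<bar> \<le> real n" .
  qed
  with A show ?thesis by blast
qed

section \<open>From the required precision to the level of the search\<close>

text \<open>The code of the list of \<open>j\<close> ones, the largest code of a binary string of
  length at most \<open>j\<close>.\<close>

definition code_bound :: "nat \<Rightarrow> nat" where
  "code_bound j = rec_nat 0 (\<lambda>_ c. Suc (prod_encode (1, c))) j"

lemma prod_encode_mono: "a \<le> a' \<Longrightarrow> b \<le> b' \<Longrightarrow> prod_encode (a, b) \<le> prod_encode (a', b')"
  unfolding prod_encode_def triangle_def by (auto intro!: add_mono div_le_mono mult_le_mono)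

lemma string_encode_le_code_bound: "length \<sigma> \<le> j \<Longrightarrow> string_encode \<sigma> \<le> code_bound j"
proof (induction j arbitrary: \<sigma>)
  case (Suc j)
  show ?case
  proof (cases \<sigma>)
    case (Cons b \<tau>)
    then have "string_encode \<tau> \<le> code_bound j" using Suc by simp
    then show ?thesis using prod_encode_mono[of "of_bool b" 1]
      by (simp add: Cons string_encode_def code_bound_def)
  qed (simp add: string_encode_def)
qed (simp add: string_encode_def)

text \<open>If \<open>z\<close> codes \<open>(j, \<epsilon>)\<close> and \<open>\<epsilon>\<close>
  has denominator \<open>q\<close>, this level exceeds the codes of all strings of length at most
  \<open>j\<close> and is at least \<open>2 * q\<close>.\<close>

definition precision_level :: "nat \<Rightarrow> nat" where
  "precision_level z = Suc (code_bound (fst (prod_decode z))) + 2 * snd (prod_decode (snd (prod_decode z)))"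

lemma rec_op_precision_level: "rec_op k F \<Longrightarrow> rec_op k (\<lambda>\<phi> xs. precision_level (F \<phi> xs))"
  unfolding precision_level_def code_bound_def
  by (intro rec_op_rec_nat rec_op_intros rec_op_pair)

lemma rec_op_length_bound: "rec_op k F \<Longrightarrow> rec_op k (\<lambda>\<phi> xs. length_bound (F \<phi> xs))"
  unfolding length_bound_def by (intro rec_op_intros)

lemma good_approx_best_code:
  assumes inv: "shift_invariant_measure \<mu>" and f: "represents f \<mu>"
    and \<phi>: "oracle_for \<phi> UNIV query_encode rat_encode f"
    and "0 < \<epsilon>" and n: "length_bound (precision_level (precision_encode (j, \<epsilon>))) \<le> n"
  shows "good_approx j \<epsilon> n (set_decode (best_code \<phi> n)) \<mu>"
proof -
  define k where "k = precision_level (precision_encode (j, \<epsilon>))"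
  obtain p q where pq: "quotient_of \<epsilon> = (p, q)" by (metis surj_pair)
  have q: "q > 0" using quotient_of_denom_pos[OF pq] .
  have k: "k = Suc (code_bound j) + 2 * nat q"
    by (simp add: k_def precision_level_def precision_encode_def rat_encode_def pq)
  have \<epsilon>: "\<epsilon> = of_int p / of_int q" by (rule quotient_of_div[OF pq])
  \<comment> \<open>The denominator alone bounds a positive rational from below, as its numerator is
    at least 1.\<close>
  with \<open>0 < \<epsilon>\<close> q have "p \<ge> 1" by (simp add: zero_less_divide_iff)
  then have \<epsilon>_ge: "1 / real_of_int q \<le> of_rat \<epsilon>" using q by (simp add: \<epsilon> of_rat_divide divide_right_mono)
  have k2: "2 * real_of_int q \<le> real k" using q by (simp add: k)
  have k0: "0 < k" by (simp add: k)
  have nk: "4 * k \<le> n" using length_bound_ge[OF k0] n by (simp add: k_def)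
  obtain A where "A \<subseteq> {..<n}" "close_counts f n k A"
    using close_counts_exists[OF inv f k0, of n] n by (auto simp: k_def)
  then have close: "close_counts f n k (set_decode (best_code \<phi> n))"
    using best_code_less_close(2)[OF \<phi>, of k n A] k0 nk by simp
  show ?thesis
    unfolding good_approx_def
  proof (intro allI impI)
    fix \<sigma> :: "bool list" assume "length \<sigma> \<le> j"
    then have "string_encode \<sigma> < k" using string_encode_le_code_bound[of \<sigma> j] by (simp add: k)
    let ?G = "real (scaled_code (rat_encode (f (\<sigma>, n))) n)" and ?N = "real (occ_count n (set_decode (best_code \<phi> n)) \<sigma>)"
    let ?p = "measure \<mu> (cylinder \<sigma>)"
    have n0: "0 < real n" using k0 nk by simp
    have "real k * \<bar>?G - ?N\<bar> \<le> real n" using close \<open>string_encode \<sigma> < k\<close> by (simp add: close_counts_def)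
    then have 1: "\<bar>?G - ?N\<bar> \<le> real n / real k" using k0 by (simp add: field_simps)
    have 2: "\<bar>?G - real n * ?p\<bar> \<le> 2" by (rule scaled_code_close[OF f])
    \<comment> \<open>The error is at most \<open>2 / n + 1 / k\<close>; with
      \<open>n \<ge> 4 * k\<close> and \<open>k \<ge> 2 * q\<close> this is at most
      \<open>3 / (4 * q) < 1 / q\<close>.\<close>
    have "\<bar>?p - ?N / real n\<bar> = \<bar>real n * ?p - ?N\<bar> / real n"
      using n0 by (simp add: field_simps abs_if split: if_splits)
    also have "\<dots> \<le> (2 + real n / real k) / real n"
      using 1 2 n0 by (intro divide_right_mono) linarith+
    also have "\<dots> = 2 / real n + 1 / real k" using n0 by (simp add: field_simps)
    also have "2 / real n \<le> 2 / (4 * real k)" using nk k0 by (intro divide_left_mono) auto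
    also have "2 / (4 * real k) + 1 / real k = (3 / 2) / real k" by simp
    also have "\<dots> \<le> (3 / 2) / (2 * real_of_int q)" using k2 q by (intro divide_left_mono) auto
    also have "\<dots> < 1 / real_of_int q" using q by (simp add: field_simps)
    also note \<epsilon>_ge
    finally show "\<bar>?p - occ_density n (set_decode (best_code \<phi> n)) \<sigma>\<bar> < of_rat \<epsilon>"
      by (simp add: occ_density_def)
  qed
qed

text \<open>
  The denominator of \<open>a / n\<close> in lowest terms is the least \<open>b > 0\<close> for which \<open>a b / n\<close> is an integer.
\<close>

definition reduced_denom :: "nat \<Rightarrow> nat \<Rightarrow> nat" where
  "reduced_denom a n = (LEAST b. n \<le> b \<or> 0 < b \<and> a * b mod n = 0)"

text \<open>The numerator in lowest terms is \<open>a * b / n\<close> for the reduced denominator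
  \<open>b\<close>; the factor 2 is \<open>int_encode\<close> on nonnegative integers.\<close>

definition fract_code :: "nat \<Rightarrow> nat \<Rightarrow> nat" where
  "fract_code a n = prod_encode (2 * (a * reduced_denom a n div n), reduced_denom a n)"

lemma rat_encode_of_nat_divide:
  assumes "coprime u v" "0 < v"
  shows "rat_encode (of_nat u / of_nat v) = prod_encode (2 * u, v)"
proof -
  have "of_nat u / of_nat v = Fract (int u) (int v)" by (simp add: Fract_of_int_quotient)
  moreover have "quotient_of (Fract (int u) (int v)) = (int u, int v)"
    using assms by (simp add: quotient_of_Fract)
  ultimately show ?thesis by (simp add: rat_encode_def int_encode_def sum_encode_def)
qed

lemma fract_code_eq:
  assumes "0 < n"
  shows "fract_code a n = rat_encode (of_nat a / of_nat n)"
proof -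
  define d where "d = gcd a n"
  have d: "0 < d" using assms by (simp add: d_def)
  obtain u v where uv: "a = u * d" "n = v * d" "coprime u v"
    using gcd_coprime_exists[of a n] d unfolding d_def by blast
  have v: "0 < v" using assms uv by (cases v) auto
  have "reduced_denom a n = v"
    unfolding reduced_denom_def
  proof (rule Least_equality)
    show "n \<le> v \<or> 0 < v \<and> a * v mod n = 0" using v by (simp add: uv ac_simps)
    fix b assume "n \<le> b \<or> 0 < b \<and> a * b mod n = 0"
    then show "v \<le> b"
    proof
      assume "n \<le> b"
      have "v * 1 \<le> v * d" using d by (intro mult_le_mono2) simp
      also have "v * d \<le> b" using \<open>n \<le> b\<close> by (simp add: uv)
      finally show ?thesis by simp
    next
      assume b: "0 < b \<and> a * b mod n = 0"
      then have "v * d dvd (u * b) * d" by (simp add: uv mod_eq_0_iff_dvd ac_simps)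
      then have "v dvd u * b" using d by simp
      then have "v dvd b" using uv(3) by (simp add: coprime_commute coprime_dvd_mult_right_iff)
      then show ?thesis using b by (simp add: dvd_imp_le)
    qed
  qed
  moreover have "a * v div n = u"
  proof -
    have "a * v = u * n" by (simp add: uv)
    then show ?thesis using assms by simp
  qed
  moreover have "of_nat a / of_nat n = (of_nat u / of_nat v :: rat)" using d by (simp add: uv)
  ultimately show ?thesis using rat_encode_of_nat_divide[OF uv(3) v] by (simp add: fract_code_def)
qed

lemma rec_op_fract_code:
  assumes F: "rec_op k F" and G: "rec_op k G"
  shows "rec_op k (\<lambda>\<phi> xs. fract_code (F \<phi> xs) (G \<phi> xs))"
  unfolding fract_code_def reduced_denom_def
  by (intro rec_op_intros rec_op_pair F G F[THEN rec_op_weaken] G[THEN rec_op_weaken])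

text \<open>
  On input \<open>(\<sigma>, i)\<close> the precision requested is \<open>j = c + 1 \<ge> |\<sigma>|\<close>, where \<open>c\<close> is the code
  of \<open>\<sigma>\<close>, and \<open>\<epsilon> = 1 / 2\<^sup>i\<close>, whose code is \<open>prod_encode (2, 2\<^sup>i)\<close>.
  The outer \<open>Suc\<close> excludes \<open>n = 0\<close>.
\<close>

definition query_length :: "(nat \<Rightarrow> nat) \<Rightarrow> nat \<Rightarrow> nat" where
  "query_length \<phi> z =
     Suc (\<phi> (2 * prod_encode (Suc (fst (prod_decode z)), prod_encode (2, 2 ^ snd (prod_decode z)))))"

definition density_code :: "(nat \<Rightarrow> nat) \<Rightarrow> nat \<Rightarrow> nat" where
  "density_code \<phi> z = fract_code
     (code_count (query_length \<phi> z) (\<phi> (Suc (2 * query_length \<phi> z))) (fst (prod_decode z)))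
     (query_length \<phi> z)"

lemma rec_op_density_code: "rec_op k F \<Longrightarrow> rec_op k (\<lambda>\<phi> xs. density_code \<phi> (F \<phi> xs))"
  unfolding density_code_def query_length_def
  by (intro rec_op_intros rec_op_pair rec_op_fract_code rec_op_code_count)

section \<open>Programs for the two directions\<close>

lemma rec_op_program:
  assumes "rec_op 1 (\<lambda>\<phi> xs. F \<phi> (hd xs))"
  obtains P where "\<And>\<phi> x. halts \<phi> P [x] (F \<phi> x)"
proof -
  from assms obtain P where P: "\<And>\<phi> xs. length xs = 1 \<Longrightarrow> halts \<phi> P xs (F \<phi> (hd xs))"
    unfolding rec_op_def by blast
  have "halts \<phi> P [x] (F \<phi> x)" for \<phi> x using P[of "[x]" \<phi>] by simp
  then show ?thesis by (rule that)
qed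

lemma approx_sequence_from_measure:
  "\<exists>m P. computable precision_dom precision_encode id m \<and>
    (\<forall>\<mu> f. shift_invariant_measure \<mu> \<longrightarrow> represents f \<mu> \<longrightarrow>
      (\<exists>A. approx_sequence m A \<mu> \<and>
        (\<forall>\<phi>. oracle_for \<phi> UNIV query_encode rat_encode f \<longrightarrow> computes P \<phi> UNIV id set_encode A)))"
proof -
  have 1: "rec_op 1 (\<lambda>\<phi> xs. length_bound (precision_level (hd xs)))"
    using rec_op_hd[of 0] by (intro rec_op_length_bound rec_op_precision_level) simp
  obtain Q where Q: "\<And>\<phi> z. halts \<phi> Q [z] (length_bound (precision_level z))"
    using rec_op_program[OF 1] by blast
  have 2: "rec_op 1 (\<lambda>\<phi> xs. best_code \<phi> (hd xs))"
    using rec_op_hd[of 0] by (intro rec_op_best_code) simp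
  obtain P where P: "\<And>\<phi> n. halts \<phi> P [n] (best_code \<phi> n)"
    using rec_op_program[OF 2] by blast
  define m where "m z = length_bound (precision_level (precision_encode z))" for z
  have "computable precision_dom precision_encode id m"
    unfolding computable_def computes_def using Q by (auto simp: m_def)
  moreover have "\<exists>A. approx_sequence m A \<mu> \<and>
      (\<forall>\<phi>. oracle_for \<phi> UNIV query_encode rat_encode f \<longrightarrow> computes P \<phi> UNIV id set_encode A)"
    if inv: "shift_invariant_measure \<mu>" and f: "represents f \<mu>" for \<mu> f
  proof -
    \<comment> \<open>\<open>A\<close> has to be fixed before the oracle is given, so it is built
      from one particular oracle for \<open>f\<close>; the search gives the same result with any
      other.\<close>
    define \<phi>\<^sub>0 where "\<phi>\<^sub>0 z = rat_encode (f (inv query_encode z))" for z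
    have "inj query_encode"
      using inj_string_encode by (auto simp: query_encode_def inj_def prod_encode_eq)
    then have \<phi>\<^sub>0: "oracle_for \<phi>\<^sub>0 UNIV query_encode rat_encode f"
      by (simp add: oracle_for_def \<phi>\<^sub>0_def)
    define A where "A n = set_decode (best_code \<phi>\<^sub>0 n)" for n
    have "approx_sequence m A \<mu>"
      unfolding approx_sequence_def A_def m_def
      using set_decode_subset[OF best_code_less_close(1)[OF \<phi>\<^sub>0]] good_approx_best_code[OF inv f \<phi>\<^sub>0]
      by blast
    moreover have "computes P \<phi> UNIV id set_encode A"
      if \<phi>: "oracle_for \<phi> UNIV query_encode rat_encode f" for \<phi>
    proof -
      have "best_code \<phi> n = best_code \<phi>\<^sub>0 n" for n
        unfolding best_code_def code_close_iff[OF \<phi>] code_close_iff[OF \<phi>\<^sub>0] ..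
      then show ?thesis using P[of \<phi>] by (simp add: computes_def A_def)
    qed
    ultimately show ?thesis by blast
  qed
  ultimately show ?thesis by blast
qed

lemma measure_from_approx_sequence:
  "\<exists>P. \<forall>\<mu> m A. approx_sequence m A \<mu> \<longrightarrow>
    (\<exists>f. represents f \<mu> \<and>
      (\<forall>\<phi> \<psi>. oracle_for \<phi> precision_dom precision_encode id m \<longrightarrow> oracle_for \<psi> UNIV id set_encode A \<longrightarrow>
        computes P (oracle_join \<phi> \<psi>) UNIV query_encode rat_encode f))"
proof -
  have 1: "rec_op 1 (\<lambda>\<phi> xs. density_code \<phi> (hd xs))"
    using rec_op_hd[of 0] by (intro rec_op_density_code) simp
  obtain P where P: "\<And>\<phi> z. halts \<phi> P [z] (density_code \<phi> z)"
    using rec_op_program[OF 1] by blast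
  have "\<exists>f. represents f \<mu> \<and>
      (\<forall>\<phi> \<psi>. oracle_for \<phi> precision_dom precision_encode id m \<longrightarrow> oracle_for \<psi> UNIV id set_encode A \<longrightarrow>
        computes P (oracle_join \<phi> \<psi>) UNIV query_encode rat_encode f)"
    if A: "approx_sequence m A \<mu>" for \<mu> m A
  proof -
    define N where "N \<sigma> i = Suc (m (Suc (string_encode \<sigma>), 1 / 2 ^ i))" for \<sigma> i
    define f where "f = (\<lambda>(\<sigma>, i). of_nat (occ_count (N \<sigma> i) (A (N \<sigma> i)) \<sigma>) / of_nat (N \<sigma> i) :: rat)"
    have "represents f \<mu>"
      unfolding represents_def
    proof (intro allI)
      fix \<sigma> i
      have "good_approx (Suc (string_encode \<sigma>)) (1 / 2 ^ i) (N \<sigma> i) (A (N \<sigma> i)) \<mu>"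
        using A by (simp add: approx_sequence_def N_def)
      moreover have "length \<sigma> \<le> Suc (string_encode \<sigma>)"
        using length_le_list_encode[of "map of_bool \<sigma>"] by (simp add: string_encode_def)
      ultimately show "\<bar>measure \<mu> (cylinder \<sigma>) - of_rat (f (\<sigma>, i))\<bar> < 1 / 2 ^ i"
        by (simp add: good_approx_def f_def occ_density_def of_rat_divide of_rat_power)
    qed
    moreover have "computes P (oracle_join \<phi> \<psi>) UNIV query_encode rat_encode f"
      if \<phi>: "oracle_for \<phi> precision_dom precision_encode id m" and \<psi>: "oracle_for \<psi> UNIV id set_encode A" for \<phi> \<psi>
    proof -
      have "density_code (oracle_join \<phi> \<psi>) (query_encode (\<sigma>, i)) = rat_encode (f (\<sigma>, i))" for \<sigma> i
      proof -
        let ?\<theta> = "oracle_join \<phi> \<psi>" and ?z = "query_encode (\<sigma>, i)"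
        have join: "?\<theta> (2 * x) = \<phi> x" "?\<theta> (Suc (2 * x)) = \<psi> x" for x
          by (simp_all add: oracle_join_def sum_decode_def)
        have "rat_encode (1 / 2 ^ i) = prod_encode (2, 2 ^ i)"
          using rat_encode_of_nat_divide[of 1 "2 ^ i"] by simp
        then have prec: "precision_encode (Suc (string_encode \<sigma>), 1 / 2 ^ i)
            = prod_encode (Suc (string_encode \<sigma>), prod_encode (2, 2 ^ i))"
          by (simp add: precision_encode_def)
        have "(Suc (string_encode \<sigma>), 1 / 2 ^ i) \<in> precision_dom" by (simp add: precision_dom_def)
        with \<phi> have "\<phi> (precision_encode (Suc (string_encode \<sigma>), 1 / 2 ^ i)) = m (Suc (string_encode \<sigma>), 1 / 2 ^ i)"
          by (simp add: oracle_for_def)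
        then have len: "query_length ?\<theta> ?z = N \<sigma> i"
          unfolding query_length_def join by (simp add: query_encode_def N_def prec)
        \<comment> \<open>\<open>set_decode\<close> inverts \<open>set_encode\<close> on finite sets
          only.\<close>
        have "finite (A n)" for n
          using A finite_subset[of "A n" "{..<n}"] by (simp add: approx_sequence_def)
        then have "set_decode (\<psi> n) = A n" for n
          using \<psi> by (simp add: oracle_for_def)
        then show ?thesis
          unfolding density_code_def len join
          by (simp add: query_encode_def code_count_eq fract_code_eq N_def f_def)
      qed
      then show ?thesis using P[of "oracle_join \<phi> \<psi>"] by (auto simp: computes_def) metis
    qed
    ultimately show ?thesis by blast
  qed
  then show ?thesis by blast
qed

theorem theorem4p1:
  shows "(\<exists>(m :: nat \<times> rat \<Rightarrow> nat) (P :: prog).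
            computable precision_dom precision_encode id m \<and>
            (\<forall>(\<mu> :: (nat \<Rightarrow> bool) measure) (f :: bool list \<times> nat \<Rightarrow> rat).
               shift_invariant_measure \<mu> \<longrightarrow> represents f \<mu> \<longrightarrow>
               (\<exists>A :: nat \<Rightarrow> nat set. approx_sequence m A \<mu> \<and>
                  (\<forall>\<phi>. oracle_for \<phi> UNIV query_encode rat_encode f \<longrightarrow>
                        computes P \<phi> UNIV id set_encode A)))) \<and>
         (\<exists>P :: prog. \<forall>(\<mu> :: (nat \<Rightarrow> bool) measure) (m :: nat \<times> rat \<Rightarrow> nat) (A :: nat \<Rightarrow> nat set).
            shift_invariant_measure \<mu> \<longrightarrow> approx_sequence m A \<mu> \<longrightarrow>
            (\<exists>f :: bool list \<times> nat \<Rightarrow> rat. represents f \<mu> \<and>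
               (\<forall>\<phi> \<psi>. oracle_for \<phi> precision_dom precision_encode id m \<longrightarrow>
                      oracle_for \<psi> UNIV id set_encode A \<longrightarrow>
                      computes P (oracle_join \<phi> \<psi>) UNIV query_encode rat_encode f)))"
  using approx_sequence_from_measure measure_from_approx_sequence by (intro conjI) blast+

end
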